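(* Consider a system of two qubits $S$ and $A$ ($n_S=n_A=2$) with nonzero interaction Hamiltonian and with control Lie algebra $\mathcal B=\mathbf 1\otimes\mathfrak{su}(2)$. Let $\mathcal L$ be its dynamical Lie algebra. Then the system is strong unitary indirectly controllable (strong UIC) if and only if it is completely controllable (CC). Explicitly, the following are equivalent: (i) (strong UIC) for all $2\times 2$ density matrices $\rho_S$ and $\rho_A$ and every $X_S\in SU(2)$ there exists $X\in e^{\mathcal L}$ such that $\mathrm{Tr}_A\bigl(X(\rho_S\otimes\rho_A)X^\dagger\bigr)=X_S\rho_SX_S^\dagger$; (ii) (CC) $e^{\mathcal L}=SU(4)$, equivalently $\mathcal L=\mathfrak{su}(4)$.
   Context: $\mathbf 1$ is the $2\times2$ identity; a density matrix is a Hermitian positive semidefinite matrix of trace $1$; $\mathfrak{su}(n)$ is the real Lie algebra of traceless skew-Hermitian $n\times n$ matrices. Let $\sigma_x=\frac i2\begin{pmatrix}0&1\\1&0\end{pmatrix}$, $\sigma_y=\frac i2\begin{pmatrix}0&i\\-i&0\end{pmatrix}$, $\sigma_z=\frac i2\begin{pmatrix}1&0\\0&-1\end{pmatrix}$. Model: the Hamiltonian of $S+A$ is $H_S+H_A+H_I+\sum_k u_k(t)\,\mathbf 1\otimes L_k$ on $\mathbb C^2\otimes\mathbb C^2$, with real control functions $u_k$, where $iH_S=iB\otimes\mathbf 1$, $iH_A=\mathbf 1\otimes iC$ with $iB,iC\in\mathfrak{su}(2)$, and $iH_I=i\tau_1\otimes\sigma_x+i\tau_2\otimes\sigma_y+i\tau_3\otimes\sigma_z$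 with $\tau_1,\tau_2,\tau_3\in\mathfrak{su}(2)$ not all zero. The control Lie algebra $\mathcal B$ is the real Lie algebra generated by the matrices $i\mathbf 1\otimes L_k$; here it is assumed equal to $\mathbf 1\otimes\mathfrak{su}(2)$. The dynamical Lie algebra $\mathcal L$ is the real Lie algebra generated by $iH_S+iH_I+iH_A$ and $\mathcal B$; $e^{\mathcal L}$ is the connected Lie group with Lie algebra $\mathcal L$. The evolution is $\dot X=-iH(u(t))X$, $X(0)=\mathbf 1\otimes\mathbf 1$, and by standard geometric control theory the set of attainable $X(T)$ is $e^{\mathcal L}$ when $e^{\mathcal L}$ is compact; all reachable sets are taken with $X\in e^{\mathcal L}$. Complete controllability means that every element of $SU(4)$ is attainable. UIC given a set $\Lambda_A$ of initial states of $A$ means that for every $\rho_S$ every density matrix unitarily equivalent to $\rho_S$ is of the form $\mathrm{Tr}_A(X(\rho_S\otimes\rho_A)X^\dagger)$ with $\rho_A\in\Lambda_A$, $X\in e^{\mathcal L}$; it is called strong if it holds independently of $\Lambda_A$ (i.e. for every fixed $\rho_A$). The partial trace $\mathrm{Tr}_A$ is the linear map with $\mathrm{Tr}_A(P\otimes Q)=\mathrm{Tr}(Q)P$. *)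

theory Defs
  imports "HOL-Analysis.Analysis"
begin

section \<open>Complex matrices\<close>

definition cscale :: "complex \<Rightarrow> complex^'n^'m \<Rightarrow> complex^'n^'m"  (infixr \<open>*\<^sub>C\<close> 75)
  where "c *\<^sub>C A = (\<chi> i j. c * A $ i $ j)"

definition dagger :: "complex^'n^'m \<Rightarrow> complex^'m^'n"
  where "dagger A = (\<chi> i j. cnj (A $ j $ i))"

definition unitary :: "complex^'n^'n \<Rightarrow> bool"
  where "unitary U \<longleftrightarrow> dagger U ** U = mat 1 \<and> U ** dagger U = mat 1"

definition SU :: "(complex^'n^'n) set"
  where "SU = {U. unitary U \<and> det U = 1}"

definition su :: "(complex^'n^'n) set"
  where "su = {A. dagger A = - A \<and> trace A = 0}"

definition hermitian :: "complex^'n^'n \<Rightarrow> bool"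
  where "hermitian A \<longleftrightarrow> dagger A = A"

text \<open>For Hermitian \<open>A\<close> the form \<open>v\<^sup>\<dagger> A v\<close> is real, so taking the real part loses nothing.\<close>

definition pos_semidef :: "complex^'n^'n \<Rightarrow> bool"
  where "pos_semidef A \<longleftrightarrow> hermitian A \<and> (\<forall>v. 0 \<le> Re (\<Sum>i\<in>UNIV. cnj (v $ i) * (A *v v) $ i))"

definition density_matrix :: "complex^'n^'n \<Rightarrow> bool"
  where "density_matrix \<rho> \<longleftrightarrow> pos_semidef \<rho> \<and> trace \<rho> = 1"

definition unitarily_equivalent :: "complex^'n^'n \<Rightarrow> complex^'n^'n \<Rightarrow> bool"
  where "unitarily_equivalent \<rho> \<rho>' \<longleftrightarrow> (\<exists>U. unitary U \<and> \<rho>' = U ** \<rho> ** dagger U)"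


section \<open>Tensor products\<close>

text \<open>
  The space \<open>\<complex>\<^sup>m \<otimes> \<complex>\<^sup>n\<close> is represented with the product index type, so that \<open>4 \<times> 4\<close> matrices
  have the index type \<open>2 \<times> 2\<close>; the first factor is the system and the second the auxiliary.
\<close>

definition kron :: "complex^'a^'b \<Rightarrow> complex^'c^'d \<Rightarrow> complex^('a \<times> 'c)^('b \<times> 'd)"  (infixr \<open>\<otimes>\<^sub>K\<close> 72)
  where "P \<otimes>\<^sub>K Q = (\<chi> p q. P $ fst p $ fst q * Q $ snd p $ snd q)"

definition ptrace_A :: "complex^('a \<times> 'c::finite)^('a \<times> 'c) \<Rightarrow> complex^'a^'a"
  where "ptrace_A X = (\<chi> i j. \<Sum>k\<in>UNIV. X $ (i, k) $ (j, k))"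

lemma ptrace_A_kron: "ptrace_A (P \<otimes>\<^sub>K Q) = trace Q *\<^sub>C P"
  by (simp add: ptrace_A_def kron_def cscale_def trace_def vec_eq_iff sum_distrib_left mult.commute)

lemma ptrace_A_add: "ptrace_A (X + Y) = ptrace_A X + ptrace_A Y"
  by (simp add: ptrace_A_def vec_eq_iff sum.distrib)

lemma ptrace_A_scale: "ptrace_A (c *\<^sub>C X) = c *\<^sub>C ptrace_A X"
  by (simp add: ptrace_A_def cscale_def vec_eq_iff sum_distrib_left)


section \<open>Lie algebras and the connected Lie group\<close>

definition commutator :: "complex^'n^'n \<Rightarrow> complex^'n^'n \<Rightarrow> complex^'n^'n"
  where "commutator X Y = X ** Y - Y ** X"

text \<open>\<open>subspace\<close> means closure under real linear combinations.\<close>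

definition real_lie_algebra :: "(complex^'n^'n) set \<Rightarrow> bool"
  where "real_lie_algebra V \<longleftrightarrow> subspace V \<and> (\<forall>X\<in>V. \<forall>Y\<in>V. commutator X Y \<in> V)"

definition lie_generated :: "(complex^'n^'n) set \<Rightarrow> (complex^'n^'n) set"
  where "lie_generated S = real_lie_algebra hull S"

text \<open>
  The power is the iterated matrix product: \<open>*\<close>, and hence \<open>^\<close>, acts entrywise on vectors.
\<close>

definition matrix_exp :: "complex^'n^'n \<Rightarrow> complex^'n^'n"
  where "matrix_exp A = (\<Sum>k. (1 / fact k) *\<^sub>R (((**) A ^^ k) (mat 1)))"

text \<open>
  The connected Lie group with Lie algebra \<open>V\<close> consists of the finite products of exponentials of
  elements of \<open>V\<close>.
\<close>

inductive_set lie_group :: "(complex^'n^'n) set \<Rightarrow> (complex^'n^'n) set"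
  for V :: "(complex^'n^'n) set" where
  one: "mat 1 \<in> lie_group V"
| exp_mult: "A \<in> V \<Longrightarrow> X \<in> lie_group V \<Longrightarrow> matrix_exp A ** X \<in> lie_group V"


section \<open>The two-qubit model\<close>

definition sigma_x :: "complex^2^2"
  where "sigma_x = (\<i> / 2) *\<^sub>C vector [vector [0, 1], vector [1, 0]]"

definition sigma_y :: "complex^2^2"
  where "sigma_y = (\<i> / 2) *\<^sub>C vector [vector [0, \<i>], vector [- \<i>, 0]]"

definition sigma_z :: "complex^2^2"
  where "sigma_z = (\<i> / 2) *\<^sub>C vector [vector [1, 0], vector [0, - 1]]"

definition H_S :: "complex^2^2 \<Rightarrow> complex^(2 \<times> 2)^(2 \<times> 2)"
  where "H_S B = B \<otimes>\<^sub>K mat 1"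

definition H_A :: "complex^2^2 \<Rightarrow> complex^(2 \<times> 2)^(2 \<times> 2)"
  where "H_A C = mat 1 \<otimes>\<^sub>K C"

definition H_I :: "complex^2^2 \<Rightarrow> complex^2^2 \<Rightarrow> complex^2^2 \<Rightarrow> complex^(2 \<times> 2)^(2 \<times> 2)"
  where "H_I \<tau>1 \<tau>2 \<tau>3 = \<tau>1 \<otimes>\<^sub>K sigma_x + \<tau>2 \<otimes>\<^sub>K sigma_y + \<tau>3 \<otimes>\<^sub>K sigma_z"

definition control_lie_algebra ::
    "'k set \<Rightarrow> ('k \<Rightarrow> complex^2^2) \<Rightarrow> (complex^(2 \<times> 2)^(2 \<times> 2)) set"
  where "control_lie_algebra K L = lie_generated ((\<lambda>k. \<i> *\<^sub>C (mat 1 \<otimes>\<^sub>K L k)) ` K)"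

definition dynamical_lie_algebra ::
    "complex^(2 \<times> 2)^(2 \<times> 2) \<Rightarrow> (complex^(2 \<times> 2)^(2 \<times> 2)) set \<Rightarrow> (complex^(2 \<times> 2)^(2 \<times> 2)) set"
  where "dynamical_lie_algebra H \<B> = lie_generated (insert (\<i> *\<^sub>C H) \<B>)"


section \<open>Controllability\<close>

text \<open>
  The set of attainable evolutions is \<open>lie_group \<L>\<close>, where \<open>\<L>\<close> is the dynamical Lie algebra.
\<close>

definition completely_controllable :: "(complex^(2 \<times> 2)^(2 \<times> 2)) set \<Rightarrow> bool"
  where "completely_controllable \<L> \<longleftrightarrow> (\<forall>X\<in>SU. X \<in> lie_group \<L>)"

definition UIC :: "(complex^(2 \<times> 2)^(2 \<times> 2)) set \<Rightarrow> (complex^2^2) set \<Rightarrow> bool"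
  where "UIC \<L> \<Lambda> \<longleftrightarrow>
    (\<forall>\<rho>S \<rho>. density_matrix \<rho>S \<longrightarrow> density_matrix \<rho> \<longrightarrow> unitarily_equivalent \<rho>S \<rho> \<longrightarrow>
      (\<exists>\<rho>A\<in>\<Lambda>. \<exists>X\<in>lie_group \<L>. \<rho> = ptrace_A (X ** (\<rho>S \<otimes>\<^sub>K \<rho>A) ** dagger X)))"

definition strong_UIC :: "(complex^(2 \<times> 2)^(2 \<times> 2)) set \<Rightarrow> bool"
  where "strong_UIC \<L> \<longleftrightarrow> (\<forall>\<rho>A. density_matrix \<rho>A \<longrightarrow> UIC \<L> {\<rho>A})"

end

theory Submission
  imports Defs
begin

text \<open>
  Write the coupling and the drift in coordinates on \<open>\<real>\<^sup>3 \<cong> su(2)\<close>, where the bracket becomes the cross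
  product. Let \<open>T\<close> consist of the \<open>x\<close> with \<open>i x \<otimes> su(2) \<subseteq> \<L>\<close> and \<open>D\<close> of the \<open>x\<close> with \<open>x \<otimes> 1 \<in> \<L>\<close>. Then
  \<open>T \<times> T \<subseteq> D\<close> and \<open>D \<times> T \<subseteq> T\<close>, and \<open>T \<noteq> 0\<close>. If \<open>T = \<real>\<^sup>3\<close> then \<open>\<L> = su(4)\<close>. Otherwise there is a unit vector \<open>c\<close>
  such that the drift on \<open>S\<close> is parallel to \<open>c\<close> and the coupling is either parallel or orthogonal
  to \<open>c\<close>. In the first case \<open>e\<^sup>\<L>\<close> commutes with \<open>c \<otimes> 1\<close>; in the second \<open>\<L>\<close> lies in a copy of \<open>sp(2)\<close>,
  so \<open>e\<^sup>\<L>\<close> commutes with an antiunitary map. Either way, for \<open>a \<bottom> c\<close>, the observable \<open>a \<otimes> 1\<close> has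
  trace zero against the whole orbit of \<open>c \<otimes> 1\<close>. Hence with the maximally mixed auxiliary state
  (a pure one would not do, as \<open>Sp(2)\<close> is transitive on pure states) the system state \<open>1/2 + i c\<close>
  cannot be turned into \<open>1/2 + i a\<close>, and strong UIC fails.

  Conversely \<open>e\<^bsup>su(n)\<^esup> = SU(n)\<close>: a unitary matrix is a product of complex reflections, which are
  exponentials of skew-Hermitian matrices of rank one; after splitting off the traces the remaining
  scalar is an \<open>n\<close>-th root of unity by the determinant condition, and so it is itself the exponential
  of a traceless diagonal matrix.
\<close>

section \<open>Complex matrices\<close>

lemma cscale_nth [simp]: "(c *\<^sub>C A) $ i $ j = c * A $ i $ j"
  by (simp add: cscale_def)

lemma dagger_nth [simp]: "dagger A $ i $ j = cnj (A $ j $ i)"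
  by (simp add: dagger_def)

lemma matrix_mult_nth: "(A ** B) $ i $ j = (\<Sum>k\<in>UNIV. A $ i $ k * B $ k $ j)"
  by (simp add: matrix_matrix_mult_def)

lemma bounded_bilinear_matrix_mult:
  "bounded_bilinear ((**) :: complex^'n^'m \<Rightarrow> complex^'k^'n \<Rightarrow> complex^'k^'m)"
  unfolding bilinear_conv_bounded_bilinear[symmetric] bilinear_def
  by (auto intro!: linearI
      simp: vec_eq_iff matrix_mult_nth sum.distrib scaleR_sum_right distrib_left distrib_right)

interpretation matrix_mult: bounded_bilinear "(**) :: complex^'n^'m \<Rightarrow> complex^'k^'n \<Rightarrow> complex^'k^'m"
  by (rule bounded_bilinear_matrix_mult)

lemma bounded_linear_matrix_vector_mult_left:
  "bounded_linear (\<lambda>A :: complex^'n^'m. A *v x)"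
  unfolding linear_conv_bounded_linear[symmetric]
  by (auto intro!: linearI
      simp: vec_eq_iff matrix_vector_mult_def sum.distrib scaleR_sum_right distrib_right)

lemma cscale_matrix_mult_left: "(c *\<^sub>C A) ** B = c *\<^sub>C (A ** B)"
  by (simp add: vec_eq_iff matrix_mult_nth sum_distrib_left mult.assoc)

lemma cscale_matrix_mult_right: "A ** (c *\<^sub>C B) = c *\<^sub>C (A ** B)"
  by (simp add: vec_eq_iff matrix_mult_nth sum_distrib_left mult.left_commute)

lemma cscale_cscale [simp]: "c *\<^sub>C d *\<^sub>C A = (c * d) *\<^sub>C A"
  by (simp add: vec_eq_iff mult.assoc)

lemma cscale_one [simp]: "1 *\<^sub>C A = A"
  by (simp add: vec_eq_iff)

lemma cscale_minus_left: "(- c) *\<^sub>C A = - (c *\<^sub>C A)"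
  by (simp add: vec_eq_iff)

lemma cscale_of_real: "complex_of_real r *\<^sub>C A = r *\<^sub>R A"
  by (simp add: vec_eq_iff scaleR_conv_of_real[where 'a = complex])

lemma bounded_linear_dagger: "bounded_linear (dagger :: complex^'n^'m \<Rightarrow> complex^'m^'n)"
  unfolding linear_conv_bounded_linear[symmetric]
  by (auto intro!: linearI simp: vec_eq_iff)

lemma dagger_add: "dagger (A + B) = dagger A + dagger B"
  and dagger_diff: "dagger (A - B) = dagger A - dagger B"
  and dagger_minus: "dagger (- A) = - dagger A"
  and dagger_scaleR: "dagger (r *\<^sub>R A) = r *\<^sub>R dagger A"
  by (simp_all add: vec_eq_iff)

lemma dagger_mult: "dagger (A ** B) = dagger B ** dagger A"
  by (simp add: vec_eq_iff matrix_mult_nth mult.commute)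

lemma dagger_dagger [simp]: "dagger (dagger A) = A"
  by (simp add: vec_eq_iff)

lemma dagger_mat_1 [simp]: "dagger (mat 1) = mat 1"
  by (simp add: vec_eq_iff mat_def)

lemma dagger_cscale: "dagger (c *\<^sub>C A) = cnj c *\<^sub>C dagger A"
  by (simp add: vec_eq_iff)

lemma trace_cscale: "trace (c *\<^sub>C A) = c * trace A"
  by (simp add: trace_def sum_distrib_left)

lemma trace_scaleR: "trace (r *\<^sub>R A) = of_real r * trace (A :: complex^'n^'n)"
  by (simp flip: cscale_of_real add: trace_cscale)

lemma trace_minus: "trace (- A) = - trace (A :: complex^'n^'n)"
  by (simp add: trace_def sum_negf)

lemma trace_dagger: "trace (dagger A) = cnj (trace A)"
  by (simp add: trace_def)

section \<open>The matrix exponential\<close>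

abbreviation mpow :: "complex^'n^'n \<Rightarrow> nat \<Rightarrow> complex^'n^'n"
  where "mpow A k \<equiv> ((**) A ^^ k) (mat 1)"

lemma mpow_intertwine:
  assumes "M ** A = A' ** M"
  shows "M ** mpow A k = mpow A' k ** M"
proof (induction k)
  case (Suc k)
  have "M ** (A ** mpow A k) = A' ** (M ** mpow A k)"
    by (simp add: matrix_mul_assoc assms)
  then show ?case by (simp add: Suc matrix_mul_assoc)
qed simp

lemma mpow_scaleR: "mpow (t *\<^sub>R A) k = t ^ k *\<^sub>R mpow A k"
  by (induction k) (simp_all add: matrix_mult.scaleR_left matrix_mult.scaleR_right)

text \<open>Bilinearity bounds the norm of a product up to a constant \<open>C\<close>, which the
  base \<open>K\<close> absorbs. This bound gives convergence of the exponential series by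
  comparison with the real one.\<close>

lemma norm_mpow_le:
  fixes A :: "complex^'n^'n"
  shows "\<exists>K\<ge>0. \<forall>k. norm (mpow A k) \<le> K ^ k * norm (mat 1 :: complex^'n^'n)"
proof -
  obtain C where C: "C > 0" "\<And>(X :: complex^'n^'n) (Y :: complex^'n^'n). norm (X ** Y) \<le> norm X * norm Y * C"
    using matrix_mult.pos_bounded by blast
  have "norm (mpow A k) \<le> (norm A * C) ^ k * norm (mat 1 :: complex^'n^'n)" for k
  proof (induction k)
    case (Suc k)
    have "norm (mpow A (Suc k)) \<le> norm A * norm (mpow A k) * C"
      using C(2) by simp
    also have "\<dots> \<le> norm A * ((norm A * C) ^ k * norm (mat 1 :: complex^'n^'n)) * C"
      using C(1) by (intro mult_left_mono mult_right_mono Suc) auto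
    finally show ?case by (simp add: mult_ac)
  qed simp
  then show ?thesis using C(1) by (intro exI[of _ "norm A * C"]) auto
qed

lemma matrix_exp_sums:
  fixes A :: "complex^'n^'n"
  shows "(\<lambda>k. (1 / fact k) *\<^sub>R mpow A k) sums matrix_exp A"
proof -
  obtain K where K: "K \<ge> 0" "\<And>k. norm (mpow A k) \<le> K ^ k * norm (mat 1 :: complex^'n^'n)"
    using norm_mpow_le[of A] by blast
  have "summable (\<lambda>k. K ^ k /\<^sub>R fact k * norm (mat 1 :: complex^'n^'n))"
    by (intro summable_mult2 summable_exp_generic)
  then have "summable (\<lambda>k. (1 / fact k) *\<^sub>R mpow A k)"
    by (rule summable_comparison_test[rotated])
       (use K in \<open>auto intro!: exI[of _ 0] simp: divide_simps mult.commute\<close>)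
  then show ?thesis
    unfolding matrix_exp_def by (rule summable_sums)
qed

lemma matrix_exp_intertwine:
  assumes "M ** A = A' ** M"
  shows "M ** matrix_exp A = matrix_exp A' ** M"
proof -
  have "(\<lambda>k. M ** ((1 / fact k) *\<^sub>R mpow A k)) sums (M ** matrix_exp A)"
    by (rule bounded_linear.sums[OF matrix_mult.bounded_linear_right matrix_exp_sums])
  moreover have "(\<lambda>k. ((1 / fact k) *\<^sub>R mpow A' k) ** M) sums (matrix_exp A' ** M)"
    by (rule bounded_linear.sums[OF matrix_mult.bounded_linear_left matrix_exp_sums])
  moreover have "M ** ((1 / fact k) *\<^sub>R mpow A k) = ((1 / fact k) *\<^sub>R mpow A' k) ** M" for k
    using mpow_intertwine[OF assms]
    by (simp add: matrix_mult.scaleR_left matrix_mult.scaleR_right)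
  ultimately show ?thesis using sums_unique2 by simp
qed

text \<open>Real linearity of \<open>h\<close> suffices, because the coefficients of the series are
  real. So this covers entrywise conjugation as well as tensoring with an identity.\<close>

lemma matrix_exp_hom:
  assumes "bounded_linear h" "h (mat 1) = mat 1" "\<And>X Y. h (X ** Y) = h X ** h Y"
  shows "h (matrix_exp A) = matrix_exp (h A)"
proof -
  interpret h: bounded_linear h by fact
  have "h (mpow A k) = mpow (h A) k" for k
    by (induction k) (simp_all add: assms)
  then have "(\<lambda>k. (1 / fact k) *\<^sub>R mpow (h A) k) sums h (matrix_exp A)"
    using h.sums[OF matrix_exp_sums, of A] by (simp add: h.scaleR)
  then show ?thesis using matrix_exp_sums sums_unique2 by blast
qed

text \<open>Adjoints reverse products, so \<open>matrix_exp_hom\<close> does not apply; what helps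
  is that a matrix commutes with its own powers.\<close>

lemma dagger_matrix_exp: "dagger (matrix_exp A) = matrix_exp (dagger A)"
proof -
  have "dagger (mpow A k) = mpow (dagger A) k" for k
  proof (induction k)
    case (Suc k)
    then show ?case using mpow_intertwine[of "dagger A" "dagger A" "dagger A" k]
      by (simp add: dagger_mult)
  qed simp
  then have "(\<lambda>k. (1 / fact k) *\<^sub>R mpow (dagger A) k) sums dagger (matrix_exp A)"
    using bounded_linear.sums[OF bounded_linear_dagger matrix_exp_sums, of A] by (simp add: dagger_scaleR)
  then show ?thesis using matrix_exp_sums sums_unique2 by blast
qed

text \<open>Serves to compute exponentials of scalar and rank-one matrices through their action on
  eigenvectors.\<close>

lemma matrix_exp_eigenvector:
  assumes "A *v x = \<mu> *s x"
  shows "matrix_exp A *v x = exp \<mu> *s x"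
proof -
  have pow: "mpow A k *v x = \<mu> ^ k *s x" for k
  proof (induction k)
    case (Suc k)
    then show ?case using assms
      by (simp flip: matrix_vector_mul_assoc
          add: vec.scale mult.commute)
  qed simp
  have "(\<lambda>k. ((1 / fact k) *\<^sub>R mpow A k) *v x) sums (matrix_exp A *v x)"
    by (rule bounded_linear.sums[OF bounded_linear_matrix_vector_mult_left matrix_exp_sums])
  moreover have "((1 / fact k) *\<^sub>R mpow A k) *v x = (\<mu> ^ k /\<^sub>R fact k) *s x" for k
    by (simp add: linear_scale[OF bounded_linear.linear[OF bounded_linear_matrix_vector_mult_left]]
        pow vec_eq_iff inverse_eq_divide)
  moreover have "bounded_linear (\<lambda>c. c *s x)"
    unfolding linear_conv_bounded_linear[symmetric]
    by (auto intro!: linearI simp: vec_eq_iff distrib_right)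
  note bounded_linear.sums[OF this exp_converges[of \<mu>]]
  ultimately show ?thesis using sums_unique2 by simp
qed

lemma matrix_exp_0 [simp]: "matrix_exp 0 = (mat 1 :: complex^'n^'n)"
proof -
  have "matrix_exp 0 *v x = mat 1 *v x" for x :: "complex^'n"
    using matrix_exp_eigenvector[of 0 x 0] by simp
  then show ?thesis by (simp add: matrix_eq)
qed

text \<open>Each entry is an everywhere convergent power series in a complex variable and may be
  differentiated termwise; the real derivative is the restriction to the real line.\<close>

lemma matrix_exp_has_vector_derivative:
  fixes A :: "complex^'n^'n"
  shows "((\<lambda>t. matrix_exp (t *\<^sub>R A)) has_vector_derivative A ** matrix_exp (t *\<^sub>R A)) (at t)"
proof -
  have entry: "((\<lambda>t. matrix_exp (t *\<^sub>R A) $ i $ j) has_vector_derivative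
      (A ** matrix_exp (t *\<^sub>R A)) $ i $ j) (at t)" for i j
  proof -
    define c where "c = (\<lambda>k. mpow A k $ i $ j / fact k)"
    have nth: "bounded_linear (\<lambda>X :: complex^'n^'n. X $ i $ j)"
      by (intro bounded_linear_compose[OF bounded_linear_vec_nth bounded_linear_vec_nth])
    obtain K where K: "K \<ge> 0" "\<And>k. norm (mpow A k) \<le> K ^ k * norm (mat 1 :: complex^'n^'n)"
      using norm_mpow_le[of A] by blast
    have summable: "summable (\<lambda>k. c k * z ^ k)" for z
    proof (rule summable_comparison_test[rotated])
      show "summable (\<lambda>k. (K * norm z) ^ k /\<^sub>R fact k * norm (mat 1 :: complex^'n^'n))"
        by (intro summable_mult2 summable_exp_generic)
      have "norm (mpow A k $ i $ j) \<le> K ^ k * norm (mat 1 :: complex^'n^'n)" for k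
        using Finite_Cartesian_Product.norm_nth_le[of "mpow A k" i]
          Finite_Cartesian_Product.norm_nth_le[of "mpow A k $ i" j] K(2)[of k] by linarith
      then have "norm (mpow A k $ i $ j) * norm z ^ k / fact k \<le>
          K ^ k * norm (mat 1 :: complex^'n^'n) * norm z ^ k / fact k" for k
        by (intro divide_right_mono mult_right_mono) auto
      moreover have "norm (c k * z ^ k) = norm (mpow A k $ i $ j) * norm z ^ k / fact k" for k
        by (simp add: c_def norm_mult norm_divide norm_power)
      ultimately have "norm (c k * z ^ k) \<le> (K * norm z) ^ k /\<^sub>R fact k * norm (mat 1 :: complex^'n^'n)" for k
        by (simp add: power_mult_distrib divide_inverse mult_ac)
      then show "\<exists>N. \<forall>k\<ge>N. norm (c k * z ^ k) \<le>
          (K * norm z) ^ k /\<^sub>R fact k * norm (mat 1 :: complex^'n^'n)"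
        by blast
    qed
    have series: "(\<lambda>k. c k * of_real t ^ k) sums (matrix_exp (t *\<^sub>R A) $ i $ j)" for t
      using bounded_linear.sums[OF nth matrix_exp_sums, of "t *\<^sub>R A"]
      by (simp add: mpow_scaleR c_def scaleR_conv_of_real[where 'a = complex] mult.commute)
    \<comment> \<open>\<open>diffs c k\<close> is \<open>(k + 1) * c (k + 1)\<close>; the factor
      cancels against the factorial and leaves one extra \<open>A\<close>.\<close>
    have "diffs c = (\<lambda>k. (A ** mpow A k) $ i $ j / fact k)"
      by (simp add: diffs_def c_def fun_eq_iff field_simps del: of_nat_Suc)
    moreover have "(\<lambda>k. (A ** ((1 / fact k) *\<^sub>R mpow (t *\<^sub>R A) k)) $ i $ j) sums
        ((A ** matrix_exp (t *\<^sub>R A)) $ i $ j)"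
      by (intro bounded_linear.sums[OF nth]
          bounded_linear.sums[OF matrix_mult.bounded_linear_right matrix_exp_sums])
    ultimately have "(\<lambda>k. diffs c k * of_real t ^ k) sums ((A ** matrix_exp (t *\<^sub>R A)) $ i $ j)"
      by (simp add: mpow_scaleR matrix_mult.scaleR_right scaleR_conv_of_real[where 'a = complex] mult.commute)
    with termdiffs_strong_converges_everywhere[OF summable, of "of_real t"]
    have "((\<lambda>z. \<Sum>k. c k * z ^ k) has_field_derivative (A ** matrix_exp (t *\<^sub>R A)) $ i $ j) (at (of_real t))"
      by (simp add: sums_iff)
    from has_vector_derivative_real_field[OF this] series show ?thesis
      by (simp add: sums_iff)
  qed
  show ?thesis
    unfolding has_vector_derivative_def has_derivative_within
  proof (intro conjI vec_tendstoI)
    show "bounded_linear (\<lambda>h. h *\<^sub>R (A ** matrix_exp (t *\<^sub>R A)))"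
      by (rule bounded_linear_scaleR_left)
  qed (use entry in \<open>simp add: has_vector_derivative_def has_derivative_within\<close>)
qed

lemma matrix_exp_has_vector_derivative_right:
  fixes A :: "complex^'n^'n"
  shows "((\<lambda>t. matrix_exp (t *\<^sub>R A)) has_vector_derivative matrix_exp (t *\<^sub>R A) ** A) (at t)"
proof -
  have "A ** matrix_exp (t *\<^sub>R A) = matrix_exp (t *\<^sub>R A) ** A"
    by (rule matrix_exp_intertwine) (simp add: matrix_mult.scaleR_left matrix_mult.scaleR_right)
  then show ?thesis using matrix_exp_has_vector_derivative[of A t] by simp
qed

text \<open>Scaling all three exponents by \<open>t\<close> gives a product with derivative zero;
  compare \<open>t = 0\<close> with \<open>t = 1\<close>. The case \<open>B = 0\<close> then
  provides inverses, from which the addition formula follows.\<close>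

lemma matrix_exp_add_mult_minus:
  fixes A B :: "complex^'n^'n"
  assumes "A ** B = B ** A"
  shows "matrix_exp (A + B) ** (matrix_exp (- A) ** matrix_exp (- B)) = mat 1"
proof -
  define E where "E = (\<lambda>(M :: complex^'n^'n) t. matrix_exp (t *\<^sub>R M))"
  have deriv: "(E M has_vector_derivative M ** E M t) (at t)" for M t
    unfolding E_def by (rule matrix_exp_has_vector_derivative)
  have deriv': "(E M has_vector_derivative E M t ** M) (at t)" for M t
    unfolding E_def by (rule matrix_exp_has_vector_derivative_right)
  have comm: "B ** E (- A) t = E (- A) t ** B" for t
    unfolding E_def using assms
    by (intro matrix_exp_intertwine)
       (simp add: matrix_mult.scaleR_left matrix_mult.scaleR_right matrix_mult.minus_left matrix_mult.minus_right)
  have "((\<lambda>t. E (A + B) t ** (E (- A) t ** E (- B) t)) has_vector_derivative 0) (at t)" for t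
  proof -
    \<comment> \<open>The generator of the first factor is put on its right, next to the other
      factors, where it cancels against theirs once \<open>B\<close> has been moved past
      \<open>E (- A) t\<close>.\<close>
    have "((\<lambda>t. E (A + B) t ** (E (- A) t ** E (- B) t)) has_vector_derivative
      E (A + B) t ** (E (- A) t ** (- B ** E (- B) t) + (- A ** E (- A) t) ** E (- B) t) +
      (E (A + B) t ** (A + B)) ** (E (- A) t ** E (- B) t)) (at t)"
      by (intro matrix_mult.has_vector_derivative deriv deriv')
    also have "E (A + B) t ** (E (- A) t ** (- B ** E (- B) t) + (- A ** E (- A) t) ** E (- B) t) +
      (E (A + B) t ** (A + B)) ** (E (- A) t ** E (- B) t) = 0"
      using comm[of t]
      by (simp add: matrix_mult.add_left matrix_mult.add_right matrix_mult.minus_left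
          matrix_mult.minus_right matrix_mul_assoc)
         (simp flip: matrix_mul_assoc
          add: matrix_mult.add_right matrix_mult.diff_right matrix_mult.minus_right)
    finally show ?thesis .
  qed
  then obtain c where c: "\<And>t. E (A + B) t ** (E (- A) t ** E (- B) t) = c"
    using has_vector_derivative_zero_constant[of UNIV "\<lambda>t. E (A + B) t ** (E (- A) t ** E (- B) t)"]
    by auto
  show ?thesis using c[of 0] c[of 1] by (simp add: E_def)
qed

lemma matrix_exp_minus: "matrix_exp A ** matrix_exp (- A) = mat 1"
  using matrix_exp_add_mult_minus[of A 0] by simp

lemma matrix_exp_add:
  assumes "A ** B = B ** A"
  shows "matrix_exp (A + B) = matrix_exp A ** matrix_exp B"
proof -
  have "matrix_exp (A + B) = matrix_exp (A + B) **
      (matrix_exp (- A) ** (matrix_exp (- B) ** matrix_exp (- (- B))) ** matrix_exp (- (- A)))"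
    by (simp add: matrix_exp_minus del: minus_minus)
  also have "\<dots> = matrix_exp (A + B) ** (matrix_exp (- A) ** matrix_exp (- B)) **
      (matrix_exp B ** matrix_exp A)"
    by (simp add: matrix_mul_assoc)
  also have "\<dots> = matrix_exp B ** matrix_exp A"
    by (simp add: matrix_exp_add_mult_minus assms)
  also have "\<dots> = matrix_exp A ** matrix_exp B"
    by (metis assms matrix_exp_intertwine)
  finally show ?thesis .
qed

section \<open>Scalar exponents and the determinant of an exponential\<close>

lemma cscale_mat_1_mult [simp]: "(c *\<^sub>C mat 1) ** M = c *\<^sub>C M"
  by (simp add: cscale_matrix_mult_left)

lemma matrix_exp_scalar: "matrix_exp (c *\<^sub>C mat 1 :: complex^'n^'n) = exp c *\<^sub>C mat 1"
proof -
  have smult: "(d *\<^sub>C mat 1) *v x = d *s x" for d and x :: "complex^'n"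
    by (simp add: vec_eq_iff matrix_vector_mult_def mat_def if_distrib if_distribR cong: if_cong)
  have "matrix_exp (c *\<^sub>C mat 1) *v x = (exp c *\<^sub>C mat 1) *v x" for x :: "complex^'n"
    by (simp add: smult matrix_exp_eigenvector)
  then show ?thesis by (simp add: matrix_eq)
qed

lemma matrix_exp_add_scalar: "matrix_exp (c *\<^sub>C mat 1 + A) = exp c *\<^sub>C matrix_exp A"
  by (subst matrix_exp_add)
     (simp_all add: cscale_matrix_mult_left cscale_matrix_mult_right matrix_exp_scalar)

text \<open>Only the identity permutation contributes to the derivative of the Leibniz sum. Any
  other permutation moves at least two indices, so an off-diagonal entry of the identity remains in
  the product after one factor has been differentiated.\<close>

lemma has_vector_derivative_det_at_mat_1:
  fixes M :: "real \<Rightarrow> complex^'n^'n"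
  assumes M: "(M has_vector_derivative A) (at t)" and "M t = mat 1"
  shows "((\<lambda>s. det (M s)) has_vector_derivative trace A) (at t)"
proof -
  have entry: "((\<lambda>s. M s $ i $ j) has_derivative (\<lambda>h. h *\<^sub>R A $ i $ j)) (at t)" for i j
  proof -
    have "bounded_linear (\<lambda>X :: complex^'n^'n. X $ i $ j)"
      by (intro bounded_linear_compose[OF bounded_linear_vec_nth bounded_linear_vec_nth])
    from bounded_linear.has_vector_derivative[OF this M] show ?thesis
      by (simp add: has_vector_derivative_def)
  qed
  let ?D = "\<lambda>h p. of_int (sign p) *
      (\<Sum>i\<in>UNIV. (h *\<^sub>R A $ i $ p i) * (\<Prod>j\<in>UNIV - {i}. M t $ j $ p j))"
  have "((\<lambda>s. det (M s)) has_derivative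
      (\<lambda>h. \<Sum>p | p permutes (UNIV :: 'n set). ?D h p)) (at t)"
    unfolding det_def by (intro has_derivative_sum has_derivative_mult_right has_derivative_prod entry)
  moreover have "?D h p = 0" if p: "p permutes UNIV" "p \<noteq> id" for h p
  proof -
    have "(\<Prod>j\<in>UNIV - {i}. M t $ j $ p j) = 0" for i
    proof -
      obtain k where k: "p k \<noteq> k" using p(2) by (auto simp: fun_eq_iff)
      have "p (p k) \<noteq> p k" using k permutes_inj[OF p(1)] by (auto dest: injD)
      with k obtain j where "j \<noteq> i" "p j \<noteq> j" by metis
      then show ?thesis by (intro prod_zero bexI[of _ j]) (auto simp: assms mat_def)
    qed
    then show ?thesis by (simp only: mult_zero_right sum.neutral_const)
  qed
  then have "(\<Sum>p | p permutes (UNIV :: 'n set). ?D h p) = ?D h id" for h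
    by (intro sum.remove[where x = id, THEN trans])
       (auto simp: finite_permutations permutes_id intro!: sum.neutral)
  moreover have "?D h id = h *\<^sub>R trace A" for h
    by (simp add: assms mat_def trace_def sign_id scaleR_sum_right)
  ultimately show ?thesis by (simp add: has_vector_derivative_def)
qed

text \<open>The determinant is multiplicative along the one-parameter group, so its derivative at
  \<open>0\<close>, the trace, determines the derivative everywhere by translation. The resulting
  linear differential equation is solved by multiplying with the inverse exponential.\<close>

lemma det_matrix_exp:
  fixes A :: "complex^'n^'n"
  shows "det (matrix_exp A) = exp (trace A)"
proof -
  define f where "f = (\<lambda>t. det (matrix_exp (t *\<^sub>R A)))"
  have f_add: "f (s + t) = f s * f t" for s t
    unfolding f_def scaleR_add_left
    by (subst matrix_exp_add) (simp_all add: det_mul matrix_mult.scaleR_left matrix_mult.scaleR_right)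
  have "((\<lambda>t. matrix_exp (t *\<^sub>R A)) has_vector_derivative A) (at 0)"
    using matrix_exp_has_vector_derivative[of A 0] by simp
  then have f0: "(f has_vector_derivative trace A) (at 0)"
    unfolding f_def by (rule has_vector_derivative_det_at_mat_1) simp
  have f': "(f has_vector_derivative trace A * f t) (at t)" for t
  proof -
    have "((\<lambda>s. s - t) has_vector_derivative 1) (at t)"
      by (auto intro!: derivative_eq_intros)
    from vector_diff_chain_at[OF this, of f "trace A"] f0
    have "((\<lambda>s. f (s - t)) has_vector_derivative trace A) (at t)"
      by (simp add: o_def)
    then have "((\<lambda>s. f (s - t) * f t) has_vector_derivative trace A * f t) (at t)"
      by (rule has_vector_derivative_mult_left)
    then show ?thesis by (simp flip: f_add)
  qed
  have "((\<lambda>t. f t * exp (t *\<^sub>R (- trace A))) has_vector_derivative 0) (at t)" for t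
    using has_vector_derivative_mult[OF f' exp_scaleR_has_vector_derivative_left[of "- trace A" t]]
    by (simp add: algebra_simps)
  then obtain c where c: "\<And>t. f t * exp (t *\<^sub>R (- trace A)) = c"
    using has_vector_derivative_zero_constant[of UNIV "\<lambda>t. f t * exp (t *\<^sub>R (- trace A))"] by auto
  show ?thesis using c[of 0] c[of 1]
    by (simp add: f_def exp_minus field_simps)
qed

section \<open>Unitary matrices as products of exponentials\<close>

definition skew_hermitian :: "(complex^'n^'n) set"
  where "skew_hermitian = {A. dagger A = - A}"

lemma su_subset_skew_hermitian: "su \<subseteq> skew_hermitian"
  by (auto simp: su_def skew_hermitian_def)

lemma unitary_matrix_exp:
  assumes "A \<in> skew_hermitian"
  shows "unitary (matrix_exp A)"
  using matrix_exp_minus[of A] matrix_exp_minus[of "- A"] assms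
  by (simp add: unitary_def skew_hermitian_def dagger_matrix_exp)

lemma unitary_mult:
  assumes "unitary U" "unitary V"
  shows "unitary (U ** V)"
proof -
  have "dagger V ** (dagger U ** U) ** V = mat 1" "U ** (V ** dagger V) ** dagger U = mat 1"
    using assms by (simp_all add: unitary_def)
  then show ?thesis by (simp add: unitary_def dagger_mult matrix_mul_assoc)
qed

lemma unitary_lie_group:
  assumes "X \<in> lie_group V" "V \<subseteq> skew_hermitian"
  shows "unitary X"
  using assms(1)
proof induction
  case (exp_mult A X)
  then show ?case using assms(2) by (auto intro: unitary_mult unitary_matrix_exp)
qed (simp add: unitary_def)

lemma lie_group_subset_SU:
  assumes "V \<subseteq> su"
  shows "lie_group V \<subseteq> SU"
proof
  fix X assume X: "X \<in> lie_group V"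
  have "det X = 1" using X
  proof induction
    case (exp_mult A X)
    then show ?case using assms by (auto simp: det_mul det_matrix_exp su_def)
  qed simp
  then show "X \<in> SU"
    using unitary_lie_group[OF X] assms su_subset_skew_hermitian by (auto simp: SU_def)
qed

lemma lie_group_mult:
  assumes "X \<in> lie_group V" "Y \<in> lie_group V"
  shows "X ** Y \<in> lie_group V"
  using assms(1)
proof induction
  case one
  then show ?case using assms(2) by simp
next
  case (exp_mult A X)
  then show ?case using lie_group.exp_mult[of A V "X ** Y"] by (simp add: matrix_mul_assoc)
qed

lemma matrix_exp_in_lie_group: "A \<in> V \<Longrightarrow> matrix_exp A \<in> lie_group V"
  using lie_group.exp_mult[OF _ lie_group.one] by fastforce

section \<open>Complex reflections\<close>

lemma sum_cnj_mult_self: "(\<Sum>i\<in>UNIV. cnj (x $ i) * x $ i) = of_real (\<Sum>i\<in>UNIV. (cmod (x $ i))\<^sup>2)"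
  unfolding of_real_sum complex_norm_square by (simp add: mult.commute)

text \<open>The matrix \<open>A\<close> is an imaginary multiple of the projection to the line through
  \<open>axis k 1 - v\<close>, so that its exponential is a complex reflection.\<close>

lemma exp_reflection:
  fixes v :: "complex^'n"
  assumes v: "(\<Sum>i\<in>UNIV. cnj (v $ i) * v $ i) = 1"
  obtains A where "A \<in> skew_hermitian" "matrix_exp A *v v = axis k 1"
    "\<And>j. j \<noteq> k \<Longrightarrow> v $ j = 0 \<Longrightarrow> matrix_exp A *v axis j 1 = axis j 1"
proof (cases "v = axis k 1")
  case True
  show thesis
    by (rule that[of 0]) (use True in \<open>auto simp: skew_hermitian_def vec_eq_iff\<close>)
next
  case False
  define w where "w = axis k 1 - v"
  define a where "a = v $ k"
  define r where "r = (\<Sum>i\<in>UNIV. cnj (w $ i) * w $ i)"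
  have w_nth: "w $ i = (if i = k then 1 else 0) - v $ i" for i
    by (simp add: w_def axis_def)
  have wv: "(\<Sum>i\<in>UNIV. cnj (w $ i) * v $ i) = a - 1"
  proof -
    have "cnj (w $ i) * v $ i = (if i = k then v $ i else 0) - cnj (v $ i) * v $ i" for i
      by (simp add: w_nth algebra_simps)
    then show ?thesis using v by (simp add: a_def sum_subtractf)
  qed
  have "(\<Sum>i\<in>UNIV. cnj (w $ i) * w $ i) = cnj (w $ k) - (\<Sum>i\<in>UNIV. cnj (w $ i) * v $ i)"
  proof -
    have "cnj (w $ i) * w $ i = (if i = k then cnj (w $ i) else 0) - cnj (w $ i) * v $ i" for i
      by (simp add: w_nth algebra_simps)
    then show ?thesis by (simp add: sum_subtractf)
  qed
  then have r: "r = (1 - cnj a) + (1 - a)"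
    using wv by (simp add: r_def w_nth a_def)
  have "r \<noteq> 0"
  proof
    assume "r = 0"
    then have "(\<Sum>i\<in>UNIV. (cmod (w $ i))\<^sup>2) = 0"
      unfolding r_def sum_cnj_mult_self by (simp only: of_real_eq_0_iff)
    then have "w = 0" by (simp add: sum_nonneg_eq_0_iff vec_eq_iff)
    then show False using False by (simp add: w_def)
  qed
  then have a: "a \<noteq> 1" "cnj a \<noteq> 1" using r by auto
  \<comment> \<open>This eigenvalue on \<open>w\<close> is forced by the wish to send
    \<open>v\<close> to \<open>axis k 1\<close>. Up to sign it is a quotient of conjugate numbers,
    hence of modulus one.\<close>
  define c where "c = - (1 - cnj a) / (1 - a)"
  have "cmod (1 - cnj a) = cmod (1 - a)"
    by (metis complex_cnj_diff complex_cnj_one complex_mod_cnj)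
  then have "cmod c = 1"
    using a norm_minus_commute[of "cnj a" 1] by (simp add: c_def norm_divide)
  then obtain \<theta> where \<theta>: "exp (\<i> * of_real \<theta>) = c"
    by (metis complex_norm_eq_1_exp mult.commute)
  define s where "s = \<i> * of_real \<theta> / r"
  \<comment> \<open>The formula for \<open>r\<close> shows that it is real, so \<open>s\<close> is
    imaginary.\<close>
  have cnj_s: "cnj s = - s"
    using r by (simp add: s_def add.commute)
  define A where "A = (\<chi> i j. s * (w $ i * cnj (w $ j)))"
  have Ax: "A *v x = (s * (\<Sum>i\<in>UNIV. cnj (w $ i) * x $ i)) *s w" for x
    by (simp add: A_def vec_eq_iff matrix_vector_mult_def sum_distrib_left mult_ac)
  have "matrix_exp A *v w = c *s w"
    using matrix_exp_eigenvector[of A w "\<i> * of_real \<theta>"] \<open>r \<noteq> 0\<close> \<theta>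
    by (simp add: Ax s_def flip: r_def)
  have fixed: "matrix_exp A *v x = x" if "(\<Sum>i\<in>UNIV. cnj (w $ i) * x $ i) = 0" for x
    using matrix_exp_eigenvector[of A x 0] that by (simp add: Ax)
  show thesis
  proof (rule that)
    show "A \<in> skew_hermitian"
      by (simp add: skew_hermitian_def A_def vec_eq_iff cnj_s mult_ac)
    show "matrix_exp A *v axis j 1 = axis j 1" if "j \<noteq> k" "v $ j = 0" for j
      by (rule fixed) (use that in \<open>simp add: w_nth axis_def if_distrib if_distribR cong: if_cong\<close>)
    \<comment> \<open>\<open>t *s w\<close> is the component of \<open>v\<close> along
      \<open>w\<close>. The exponential multiplies it by \<open>c\<close> and fixes the remainder,
      which is orthogonal to \<open>w\<close>.\<close>
    define t where "t = (a - 1) / r"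
    have "(\<Sum>i\<in>UNIV. cnj (w $ i) * (v - t *s w) $ i) = (\<Sum>i\<in>UNIV. cnj (w $ i) * v $ i) - t * r"
      by (simp add: right_diff_distrib sum_subtractf r_def sum_distrib_left mult.left_commute)
    then have "(\<Sum>i\<in>UNIV. cnj (w $ i) * (v - t *s w) $ i) = 0"
      using \<open>r \<noteq> 0\<close> unfolding wv t_def by simp
    from fixed[OF this] have "matrix_exp A *v v = v + (t * (c - 1)) *s w"
      using \<open>matrix_exp A *v w = c *s w\<close>
      by (simp add: matrix_vector_mult_diff_distrib vec.scale vec_eq_iff algebra_simps)
    also have "t * (c - 1) = 1"
    proof -
      have "c - 1 = - r / (1 - a)" using a by (simp add: c_def r field_simps)
      then show ?thesis using a \<open>r \<noteq> 0\<close> by (simp add: t_def field_simps)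
    qed
    finally show "matrix_exp A *v v = axis k 1" by (simp add: w_def)
  qed
qed

lemma unitary_nth_inner:
  assumes "unitary U"
  shows "(\<Sum>i\<in>UNIV. cnj (U $ i $ j) * U $ i $ k) = (if j = k then 1 else 0)"
proof -
  have "(dagger U ** U) $ j $ k = (if j = k then 1 else 0)"
    using assms by (simp add: unitary_def mat_def)
  then show ?thesis by (simp add: matrix_mult_nth)
qed

lemma matrix_vector_mult_axis_nth: "(A *v axis k 1) $ i = (A $ i $ k :: 'a :: semiring_1)"
  by (simp add: matrix_vector_mult_def axis_def if_distrib cong: if_cong)

text \<open>Induction on a set \<open>S\<close> outside which the basis vectors are fixed. A
  reflection sends column \<open>k\<close> to the \<open>k\<close>-th basis vector. It keeps the
  basis vectors that are already fixed, because column \<open>k\<close> is orthogonal to them and so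
  has entry zero there.\<close>

lemma unitary_in_lie_group_skew_hermitian:
  fixes U :: "complex^'n^'n"
  assumes "unitary U"
  shows "U \<in> lie_group skew_hermitian"
proof -
  have "U \<in> lie_group skew_hermitian"
    if "finite S" "unitary U" "\<And>j. j \<notin> S \<Longrightarrow> U *v axis j 1 = axis j 1" for S and U :: "complex^'n^'n"
    using that
  proof (induction S arbitrary: U rule: finite_induct)
    case empty
    then have "U = mat 1"
      by (simp add: vec_eq_iff axis_def mat_def flip: matrix_vector_mult_axis_nth)
    then show ?case by (simp add: lie_group.one)
  next
    case (insert k S)
    define v where "v = U *v axis k 1"
    have v_nth: "v $ i = U $ i $ k" for i
      by (simp add: v_def matrix_vector_mult_axis_nth)
    have "(\<Sum>i\<in>UNIV. cnj (v $ i) * v $ i) = 1"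
      using unitary_nth_inner[OF insert.prems(1), of k k] by (simp add: v_nth)
    then obtain A where A: "A \<in> skew_hermitian" "matrix_exp A *v v = axis k 1"
      "\<And>j. j \<noteq> k \<Longrightarrow> v $ j = 0 \<Longrightarrow> matrix_exp A *v axis j 1 = axis j 1"
      using exp_reflection by blast
    have "(matrix_exp A ** U) *v axis j 1 = axis j 1" if "j \<notin> S" for j
    proof (cases "j = k")
      case True
      then show ?thesis using A(2) by (simp add: v_def flip: matrix_vector_mul_assoc)
    next
      case False
      then have Uj: "U *v axis j 1 = axis j 1" using that insert.prems(2) by simp
      have "cnj (U $ i $ j) * U $ i $ k = (if i = j then v $ j else 0)" for i
        unfolding matrix_vector_mult_axis_nth[of U j, symmetric] Uj by (simp add: axis_def v_nth)
      then have "v $ j = 0"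
        using unitary_nth_inner[OF insert.prems(1), of j k] False by simp
      then show ?thesis using A(3) False Uj by (simp flip: matrix_vector_mul_assoc)
    qed
    then have "matrix_exp A ** U \<in> lie_group skew_hermitian"
      using insert.prems(1) A(1) by (intro insert.IH unitary_mult unitary_matrix_exp)
    moreover have "- A \<in> skew_hermitian"
      using A(1) by (simp add: skew_hermitian_def dagger_minus)
    ultimately have "matrix_exp (- A) ** (matrix_exp A ** U) \<in> lie_group skew_hermitian"
      by (rule lie_group.exp_mult[rotated])
    then show ?case
      using matrix_exp_minus[of "- A"] by (simp add: matrix_mul_assoc)
  qed
  from this[of UNIV U] assms show ?thesis by simp
qed

section \<open>Splitting phases off a unitary matrix\<close>

lemma trace_skew_hermitian:
  assumes "A \<in> skew_hermitian"
  shows "trace A = \<i> * of_real (Im (trace A))"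
proof -
  have "cnj (trace A) = - trace A"
    using assms by (simp add: skew_hermitian_def trace_minus flip: trace_dagger)
  then show ?thesis by (simp add: complex_eq_iff)
qed

lemma det_cscale: "det (c *\<^sub>C A :: complex^'n^'n) = c ^ CARD('n) * det A"
  using det_rows_mul[of "\<lambda>_. c" "\<lambda>i. A $ i"] by (simp add: cscale_def vector_scalar_mult_def)

text \<open>Subtracting the mean of the diagonal makes each exponent traceless. The scalars split
  off commute with everything and collect into a single phase.\<close>

lemma lie_group_skew_hermitian_split:
  fixes X :: "complex^'n^'n"
  assumes "X \<in> lie_group skew_hermitian"
  shows "\<exists>\<phi> :: real. \<exists>Y \<in> lie_group su. X = exp (\<i> * of_real \<phi>) *\<^sub>C Y"
  using assms
proof induction
  case one
  show ?case by (intro exI[of _ 0] bexI[of _ "mat 1"] lie_group.one) simp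
next
  case (exp_mult A X)
  then obtain \<phi> :: real and Y where Y: "Y \<in> lie_group su" "X = exp (\<i> * of_real \<phi>) *\<^sub>C Y"
    by blast
  define c where "c = Im (trace A) / CARD('n)"
  define A' where "A' = A - (\<i> * of_real c) *\<^sub>C mat 1"
  have "trace A' = 0"
    using trace_skew_hermitian[OF exp_mult.hyps(1)]
    by (simp add: A'_def trace_sub trace_cscale trace_I c_def)
  then have "A' \<in> su"
    using exp_mult.hyps(1)
    by (simp add: su_def A'_def skew_hermitian_def dagger_diff dagger_cscale vec_eq_iff mat_def)
  then have "matrix_exp A' ** Y \<in> lie_group su"
    using Y(1) by (rule lie_group.exp_mult)
  moreover have "matrix_exp A = exp (\<i> * of_real c) *\<^sub>C matrix_exp A'"
    unfolding matrix_exp_add_scalar[symmetric] by (simp add: A'_def)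
  then have "matrix_exp A ** X = exp (\<i> * of_real (c + \<phi>)) *\<^sub>C (matrix_exp A' ** Y)"
    by (simp add: Y(2) cscale_matrix_mult_left cscale_matrix_mult_right exp_add distrib_left mult.commute)
  ultimately show ?case by blast
qed

text \<open>The single diagonal entry of \<open>P\<close> cancels the trace of the scalar exponent,
  while the exponential of \<open>P\<close> is the identity because the phase is a root of unity.
  Adding \<open>P\<close> therefore makes the exponent traceless without changing its
  exponential.\<close>

lemma root_of_unity_in_lie_group_su:
  assumes "exp (\<i> * of_real \<phi>) ^ CARD('n) = 1"
  shows "(exp (\<i> * of_real \<phi>) *\<^sub>C mat 1 :: complex^'n^'n) \<in> lie_group su"
proof -
  obtain k :: 'n where True by simp
  define P :: "complex^'n^'n" where "P = (\<chi> i j. if i = k \<and> j = k then - \<i> * of_real \<phi> * CARD('n) else 0)"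
  have Px: "P *v x = axis k (- \<i> * of_real \<phi> * CARD('n) * x $ k)" for x
  proof -
    have "(P *v x) $ i = axis k (- \<i> * of_real \<phi> * CARD('n) * x $ k) $ i" for i
      by (cases "i = k") (simp_all add: matrix_vector_mult_def P_def axis_def mult_delta_left)
    then show ?thesis by (simp add: vec_eq_iff)
  qed
  have "exp (- \<i> * of_real \<phi> * CARD('n)) = 1"
    using assms by (simp add: exp_minus mult.commute flip: exp_of_nat_mult)
  then have "matrix_exp P *v x = mat 1 *v x" for x
  proof -
    have ker: "matrix_exp P *v y = y" if "y $ k = 0" for y
      using matrix_exp_eigenvector[of P y 0] that by (simp add: Px axis_eq_0_iff)
    have "matrix_exp P *v axis k c = axis k c" for c
      using matrix_exp_eigenvector[of P "axis k c" "- \<i> * of_real \<phi> * CARD('n)"]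
        \<open>exp (- \<i> * of_real \<phi> * CARD('n)) = 1\<close>
      by (simp add: Px vec_eq_iff axis_def)
    from this[of "x $ k"] ker[of "x - axis k (x $ k)"] show ?thesis
      by (simp add: matrix_vector_mult_diff_distrib axis_def)
  qed
  then have "matrix_exp P = mat 1" by (simp add: matrix_eq)
  then have exp: "matrix_exp ((\<i> * of_real \<phi>) *\<^sub>C mat 1 + P) = exp (\<i> * of_real \<phi>) *\<^sub>C mat 1"
    by (simp add: matrix_exp_add_scalar)
  have "trace P = - \<i> * of_real \<phi> * CARD('n)"
  proof -
    have "trace P = (\<Sum>i\<in>UNIV. if i = k then - \<i> * of_real \<phi> * CARD('n) else 0)"
      by (simp add: P_def trace_def)
    then show ?thesis by simp
  qed
  moreover have "dagger P = - P" by (auto simp: P_def vec_eq_iff)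
  ultimately have "(\<i> * of_real \<phi>) *\<^sub>C mat 1 + P \<in> su"
    by (simp add: su_def dagger_add dagger_cscale cscale_minus_left trace_add trace_cscale trace_I)
  from matrix_exp_in_lie_group[OF this] show ?thesis by (simp add: exp)
qed

theorem lie_group_su: "lie_group su = (SU :: (complex^'n^'n) set)"
proof
  show "lie_group su \<subseteq> (SU :: (complex^'n^'n) set)"
    by (rule lie_group_subset_SU) simp
  show "(SU :: (complex^'n^'n) set) \<subseteq> lie_group su"
  proof
    fix X :: "complex^'n^'n" assume X: "X \<in> SU"
    then have "X \<in> lie_group skew_hermitian"
      by (intro unitary_in_lie_group_skew_hermitian) (simp add: SU_def)
    then obtain \<phi> :: real and Y where Y: "Y \<in> lie_group su" "X = exp (\<i> * of_real \<phi>) *\<^sub>C Y"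
      using lie_group_skew_hermitian_split by blast
    have "det Y = 1" using Y(1) lie_group_subset_SU[of su] by (auto simp: SU_def)
    then have "exp (\<i> * of_real \<phi>) ^ CARD('n) = 1"
      using X by (simp add: SU_def Y(2) det_cscale)
    from lie_group_mult[OF root_of_unity_in_lie_group_su[OF this] Y(1)]
    show "X \<in> lie_group su" by (simp add: Y(2))
  qed
qed

section \<open>Tensor products and Lie algebras\<close>

lemma kron_nth [simp]: "(P \<otimes>\<^sub>K Q) $ p $ q = P $ fst p $ fst q * Q $ snd p $ snd q"
  by (simp add: kron_def)

lemma bounded_bilinear_kron:
  "bounded_bilinear ((\<otimes>\<^sub>K) :: complex^'a^'b \<Rightarrow> complex^'c^'d \<Rightarrow> complex^('a \<times> 'c)^('b \<times> 'd))"
  unfolding bilinear_conv_bounded_bilinear[symmetric] bilinear_def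
  by (auto intro!: linearI simp: vec_eq_iff distrib_left distrib_right)

interpretation kron: bounded_bilinear
  "(\<otimes>\<^sub>K) :: complex^'a^'b \<Rightarrow> complex^'c^'d \<Rightarrow> complex^('a \<times> 'c)^('b \<times> 'd)"
  by (rule bounded_bilinear_kron)

lemma kron_cscale_left: "(c *\<^sub>C P) \<otimes>\<^sub>K Q = c *\<^sub>C (P \<otimes>\<^sub>K Q)"
  by (simp add: vec_eq_iff mult.assoc)

lemma kron_cscale_right: "P \<otimes>\<^sub>K (c *\<^sub>C Q) = c *\<^sub>C (P \<otimes>\<^sub>K Q)"
  by (simp add: vec_eq_iff mult.left_commute)

lemma sum_UNIV_prod:
  "(\<Sum>p\<in>UNIV. f p) = (\<Sum>i\<in>UNIV. \<Sum>j\<in>UNIV. f (i :: 'a :: finite, j :: 'b :: finite))"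
  by (simp add: sum.cartesian_product)

lemma kron_mult: "(P \<otimes>\<^sub>K Q) ** (R \<otimes>\<^sub>K S) = (P ** R) \<otimes>\<^sub>K (Q ** S)"
  by (simp add: vec_eq_iff matrix_mult_nth sum_UNIV_prod sum_product mult_ac)

lemma kron_mat_1: "mat 1 \<otimes>\<^sub>K mat 1 = mat 1"
  by (auto simp: vec_eq_iff mat_def prod_eq_iff)

lemma dagger_kron: "dagger (P \<otimes>\<^sub>K Q) = dagger P \<otimes>\<^sub>K dagger Q"
  by (simp add: vec_eq_iff)

lemma trace_kron: "trace (P \<otimes>\<^sub>K Q) = trace P * trace Q"
  by (simp add: trace_def sum_UNIV_prod sum_product)

text \<open>The partial trace is dual to tensoring with the identity. This turns expectations in the
  reduced state into expectations in the joint state.\<close>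

lemma trace_mult_ptrace_A: "trace (M ** ptrace_A Y) = trace ((M \<otimes>\<^sub>K mat 1) ** Y)"
proof -
  have "(\<Sum>j\<in>UNIV. \<Sum>l\<in>UNIV. M $ i $ j * mat 1 $ k $ l * Y $ (j, l) $ (i, k)) =
      (\<Sum>j\<in>UNIV. M $ i $ j * Y $ (j, k) $ (i, k))" for i k
    by (intro sum.cong refl) (simp add: mat_def mult_delta_left mult_delta_right)
  then show ?thesis
    unfolding trace_def matrix_mult_nth ptrace_A_def
    by (simp add: sum_UNIV_prod sum_distrib_left) (intro sum.cong refl sum.swap)
qed

lemma trace_mult_cycle: "trace (A ** B ** C) = trace (C ** A ** (B :: complex^'n^'n))"
  by (metis trace_mul_sym matrix_mul_assoc)

section \<open>Generated real Lie algebras\<close>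

lemma real_lie_algebra_lie_generated: "real_lie_algebra (lie_generated S)"
  unfolding lie_generated_def
proof (rule hull_in)
  fix T :: "(complex^'n^'n) set set"
  assume "Ball T real_lie_algebra"
  then show "real_lie_algebra (\<Inter> T)"
    by (auto simp: real_lie_algebra_def intro!: subspace_Inter)
qed

lemma lie_generated_superset: "S \<subseteq> lie_generated S"
  unfolding lie_generated_def by (rule hull_subset)

lemma lie_generated_minimal: "S \<subseteq> V \<Longrightarrow> real_lie_algebra V \<Longrightarrow> lie_generated S \<subseteq> V"
  unfolding lie_generated_def by (rule hull_minimal)

lemma subspace_su: "subspace su"
proof (rule subspaceI)
  show "0 \<in> su" by (simp add: su_def vec_eq_iff trace_def)
qed (simp_all add: su_def dagger_add dagger_scaleR trace_add trace_scaleR)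

lemma real_lie_algebra_su: "real_lie_algebra su"
  by (auto simp: real_lie_algebra_def subspace_su[unfolded su_def] commutator_def su_def dagger_diff dagger_mult
      trace_sub matrix_mult.minus_left matrix_mult.minus_right intro: trace_mul_sym)

section \<open>The Lie algebra \<open>su\<close> of \<open>2 \<times> 2\<close> matrices\<close>

text \<open>With the factor one half in the \<open>sigma\<close> matrices, the bracket becomes the
  cross product without any constant.\<close>

definition su2 :: "real^3 \<Rightarrow> complex^2^2"
  where "su2 x = x $ 1 *\<^sub>R sigma_x + x $ 2 *\<^sub>R sigma_y + x $ 3 *\<^sub>R sigma_z"

lemma su2_nth:
  "su2 x $ 1 $ 1 = \<i> * of_real (x $ 3) / 2"
  "su2 x $ 1 $ 2 = (\<i> * of_real (x $ 1) - of_real (x $ 2)) / 2"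
  "su2 x $ 2 $ 1 = (\<i> * of_real (x $ 1) + of_real (x $ 2)) / 2"
  "su2 x $ 2 $ 2 = - \<i> * of_real (x $ 3) / 2"
  by (simp_all add: su2_def sigma_x_def sigma_y_def sigma_z_def complex_eq_iff)

lemma mat_1_2_nth:
  "(mat 1 :: complex^2^2) $ 1 $ 1 = 1" "(mat 1 :: complex^2^2) $ 1 $ 2 = 0"
  "(mat 1 :: complex^2^2) $ 2 $ 1 = 0" "(mat 1 :: complex^2^2) $ 2 $ 2 = 1"
  by (simp_all add: mat_def)

lemma su2_eq_sigma:
  "su2 (axis 1 1) = sigma_x" "su2 (axis 2 1) = sigma_y" "su2 (axis 3 1) = sigma_z"
  by (simp_all add: su2_def axis_def)

lemma linear_su2: "linear su2"
  by (auto intro!: linearI simp: su2_def algebra_simps)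

lemmas su2_add = linear_add[OF linear_su2]
  and su2_diff = linear_diff[OF linear_su2]
  and su2_minus = linear_neg[OF linear_su2]
  and su2_scaleR = linear_scale[OF linear_su2]
  and su2_0 = linear_0[OF linear_su2]

text \<open>This is the product of pure quaternions, with \<open>su2 x\<close> in the role of half
  of \<open>x\<close>. Commutators, squares and traces below are read off from it.\<close>

lemma su2_mult: "su2 x ** su2 y = (1 / 2) *\<^sub>R su2 (cross3 x y) - (x \<bullet> y / 4) *\<^sub>R mat 1"
  by (simp add: vec_eq_iff forall_2 matrix_mult_nth sum_2 su2_nth mat_1_2_nth cross_components
      inner_vec_def sum_3 complex_eq_iff field_simps)

lemma commutator_su2: "commutator (su2 x) (su2 y) = su2 (cross3 x y)"
  by (simp add: commutator_def su2_mult cross_skew[of y x] su2_minus inner_commute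
      flip: scaleR_left_distrib)

lemma trace_su2: "trace (su2 x) = 0"
  by (simp add: trace_def sum_2 su2_nth)

lemma trace_su2_mult: "trace (su2 x ** su2 y) = - of_real (x \<bullet> y) / 2"
  by (simp add: su2_mult trace_sub trace_scaleR trace_su2 trace_I)

lemma dagger_su2: "dagger (su2 x) = - su2 x"
  by (simp add: vec_eq_iff forall_2 su2_nth complex_eq_iff)

lemma skew_hermitian_eq_su2:
  assumes "dagger A = - A"
  obtains x b where "A = su2 x + (\<i> * of_real b) *\<^sub>C mat 1"
proof
  have A: "cnj (A $ j $ i) = - A $ i $ j" for i j
    using assms by (simp add: vec_eq_iff)
  show "A = su2 (vector [Im (A $ 1 $ 2) + Im (A $ 2 $ 1), Re (A $ 2 $ 1) - Re (A $ 1 $ 2), Im (A $ 1 $ 1) - Im (A $ 2 $ 2)])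
      + (\<i> * of_real ((Im (A $ 1 $ 1) + Im (A $ 2 $ 2)) / 2)) *\<^sub>C mat 1"
    using A[of 1 1] A[of 1 2] A[of 2 2]
    by (simp add: vec_eq_iff forall_2 su2_nth mat_1_2_nth complex_eq_iff field_simps)
qed

lemma su_eq_range_su2: "su = range su2"
proof (intro equalityI subsetI)
  fix A :: "complex^2^2" assume A: "A \<in> su"
  then obtain x b where x: "A = su2 x + (\<i> * of_real b) *\<^sub>C mat 1"
    using skew_hermitian_eq_su2[of A] by (auto simp: su_def)
  then have "trace A = 2 * (\<i> * of_real b)"
    by (simp add: trace_add trace_su2 trace_cscale trace_I)
  then have "b = 0" using A by (simp add: su_def)
  then have "A = su2 x" by (simp add: x vec_eq_iff)
  then show "A \<in> range su2" by blast
qed (auto simp: su_def dagger_su2 trace_su2)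

lemma commutator_add_left: "commutator (A + B) C = commutator A C + commutator B C"
  by (simp add: commutator_def matrix_mult.add_left matrix_mult.add_right)

lemma commutator_cscale_left: "commutator (c *\<^sub>C A) B = c *\<^sub>C commutator A B"
  and commutator_cscale_right: "commutator A (c *\<^sub>C B) = c *\<^sub>C commutator A B"
  by (simp_all add: commutator_def cscale_matrix_mult_left cscale_matrix_mult_right vec_eq_iff
      right_diff_distrib)

lemma commutator_kron_mat_1_left:
  "commutator (P \<otimes>\<^sub>K mat 1) (R \<otimes>\<^sub>K S) = commutator P R \<otimes>\<^sub>K S"
  by (simp add: commutator_def kron_mult kron.diff_left)

lemma commutator_kron_mat_1_right:
  "commutator (P \<otimes>\<^sub>K Q) (mat 1 \<otimes>\<^sub>K S) = P \<otimes>\<^sub>K commutator Q S"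
  by (simp add: commutator_def kron_mult kron.diff_right)

lemma commutator_mat_1 [simp]: "commutator (mat 1) A = 0"
  by (simp add: commutator_def)

text \<open>The common second factor has a negative scalar as its square, so the commutator acts on
  the system alone; the two factors \<open>\<i>\<close> make the sign positive.\<close>

lemma cscale_su2_kron_commutator:
  "commutator (\<i> *\<^sub>C (su2 x \<otimes>\<^sub>K su2 y)) (\<i> *\<^sub>C (su2 x' \<otimes>\<^sub>K su2 y)) =
    (y \<bullet> y / 4) *\<^sub>R (su2 (cross3 x x') \<otimes>\<^sub>K mat 1)"
proof -
  have "su2 y ** su2 y = - (y \<bullet> y / 4) *\<^sub>R mat 1"
    by (simp add: su2_mult su2_0)
  then show ?thesis
    unfolding commutator_su2[symmetric]
    by (simp add: commutator_def cscale_matrix_mult_left cscale_matrix_mult_right cscale_minus_left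
        kron_mult kron.minus_right kron.scaleR_right kron.diff_left scaleR_diff_right)
qed

text \<open>The matrix is cut into blocks by the system index, \<open>P\<close> and \<open>R\<close>
  on the diagonal and \<open>Q\<close> above it, and then expanded in the identity and the three
  \<open>sigma\<close> matrices of the system.\<close>

lemma su_4_subset:
  assumes V: "subspace V"
    and left: "\<And>x. su2 x \<otimes>\<^sub>K mat 1 \<in> V" and right: "\<And>y. mat 1 \<otimes>\<^sub>K su2 y \<in> V"
    and both: "\<And>x y. \<i> *\<^sub>C (su2 x \<otimes>\<^sub>K su2 y) \<in> V"
  shows "su \<subseteq> V"
proof
  fix X :: "complex^(2 \<times> 2)^(2 \<times> 2)" assume X: "X \<in> su"
  \<comment> \<open>The imaginary scalar part of \<open>Q\<close> turns into a real multiple of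
    \<open>su2 x \<otimes>\<^sub>K mat 1\<close>.\<close>
  have skew: "\<i> *\<^sub>C (su2 x \<otimes>\<^sub>K Q) \<in> V" if "dagger Q = - Q" for x Q
  proof -
    from that obtain y b where Q: "Q = su2 y + (\<i> * of_real b) *\<^sub>C mat 1"
      by (rule skew_hermitian_eq_su2)
    have "\<i> *\<^sub>C (su2 x \<otimes>\<^sub>K Q) = \<i> *\<^sub>C (su2 x \<otimes>\<^sub>K su2 y) - b *\<^sub>R (su2 x \<otimes>\<^sub>K mat 1)"
      by (simp add: Q vec_eq_iff scaleR_conv_of_real[where 'a = complex] algebra_simps)
    then show ?thesis using both left V by (simp add: subspace_diff subspace_scale)
  qed
  define P where "P = (\<chi> i j. X $ (1, i) $ (1, j))"
  define Q where "Q = (\<chi> i j. X $ (1, i) $ (2, j))"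
  define R where "R = (\<chi> i j. X $ (2, i) $ (2, j))"
  have X_nth: "cnj (X $ q $ p) = - X $ p $ q" for p q
  proof -
    have "dagger X $ p $ q = (- X) $ p $ q"
      using X by (simp only: su_def mem_Collect_eq)
    then show ?thesis by simp
  qed
  have P: "dagger P = - P" and R: "dagger R = - R"
    by (simp_all add: P_def R_def vec_eq_iff X_nth)
  have "trace P + trace R = trace X"
    by (simp add: P_def R_def trace_def sum_UNIV_prod sum_2)
  \<comment> \<open>Here \<open>trace X = 0\<close> enters: it makes the coefficient of the identity
    traceless.\<close>
  then have "(1 / 2) *\<^sub>R (P + R) \<in> su"
    using X P R
    by (simp add: su_def dagger_scaleR dagger_add trace_scaleR trace_add scaleR_add_right scaleR_diff_right
        flip: add_divide_distrib)
  then have "mat 1 \<otimes>\<^sub>K ((1 / 2) *\<^sub>R (P + R)) \<in> V"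
    using right by (auto simp: su_eq_range_su2)
  moreover have "\<i> *\<^sub>C (su2 (axis 3 1) \<otimes>\<^sub>K (R - P)) \<in> V"
    "\<i> *\<^sub>C (su2 (axis 1 1) \<otimes>\<^sub>K (dagger Q - Q)) \<in> V"
    "\<i> *\<^sub>C (su2 (axis 2 1) \<otimes>\<^sub>K (\<i> *\<^sub>C (Q + dagger Q))) \<in> V"
    using P R by (auto intro!: skew simp: dagger_diff dagger_add dagger_cscale cscale_minus_left add.commute)
  moreover have "X = mat 1 \<otimes>\<^sub>K ((1 / 2) *\<^sub>R (P + R)) + \<i> *\<^sub>C (su2 (axis 3 1) \<otimes>\<^sub>K (R - P)) +
    \<i> *\<^sub>C (su2 (axis 1 1) \<otimes>\<^sub>K (dagger Q - Q)) +
    \<i> *\<^sub>C (su2 (axis 2 1) \<otimes>\<^sub>K (\<i> *\<^sub>C (Q + dagger Q)))"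
    using X_nth[of "(1, _)" "(2, _)"]
    by (simp add: vec_eq_iff split_paired_all split_paired_All forall_2 su2_nth mat_1_2_nth
        P_def Q_def R_def X_nth axis_def field_simps)
  ultimately show "X \<in> V" using V by (simp add: subspace_add)
qed

section \<open>Lie algebras containing every control on the auxiliary system\<close>

locale locally_controlled =
  fixes V :: "(complex^(2 \<times> 2)^(2 \<times> 2)) set"
  assumes real_lie_algebra: "real_lie_algebra V"
    and control: "mat 1 \<otimes>\<^sub>K su2 y \<in> V"
begin

definition coupling :: "(real^3) set"
  where "coupling = {x. \<forall>y. \<i> *\<^sub>C (su2 x \<otimes>\<^sub>K su2 y) \<in> V}"

definition drift :: "(real^3) set"
  where "drift = {x. su2 x \<otimes>\<^sub>K mat 1 \<in> V}"

lemma subspace: "subspace V"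
  using real_lie_algebra by (simp add: real_lie_algebra_def)

lemma commutator_in: "X \<in> V \<Longrightarrow> Y \<in> V \<Longrightarrow> commutator X Y \<in> V"
  using real_lie_algebra by (simp add: real_lie_algebra_def)

lemma subspace_drift: "subspace drift"
  using subspace
  by (auto intro!: subspaceI simp: drift_def su2_0 su2_add su2_scaleR kron.zero_left kron.add_left
      kron.scaleR_left subspace_0 subspace_add subspace_scale)

lemma subspace_coupling: "subspace coupling"
proof (rule subspaceI)
  have scale: "c *\<^sub>C (r *\<^sub>R A) = r *\<^sub>R (c *\<^sub>C A)" and add: "c *\<^sub>C (A + B) = c *\<^sub>C A + c *\<^sub>C B"
    and zero: "c *\<^sub>C 0 = 0" for c r and A B :: "complex^(2 \<times> 2)^(2 \<times> 2)"
    by (simp_all add: vec_eq_iff distrib_left)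
  show "0 \<in> coupling"
    using subspace by (simp add: coupling_def su2_0 kron.zero_left zero subspace_0)
  show "x + y \<in> coupling" if "x \<in> coupling" "y \<in> coupling" for x y
    using subspace that by (simp add: coupling_def su2_add add kron.add_left subspace_add)
  show "r *\<^sub>R x \<in> coupling" if "x \<in> coupling" for r x
    using subspace that by (simp add: coupling_def su2_scaleR scale kron.scaleR_left subspace_scale)
qed

lemma coupling_cross: "x \<in> coupling \<Longrightarrow> y \<in> coupling \<Longrightarrow> cross3 x y \<in> drift"
proof -
  assume "x \<in> coupling" "y \<in> coupling"
  \<comment> \<open>The vector \<open>axis 1 2\<close> has length two, so that the factor
    \<open>y \<bullet> y / 4\<close> is one.\<close>
  then have "commutator (\<i> *\<^sub>C (su2 x \<otimes>\<^sub>K su2 (axis 1 2))) (\<i> *\<^sub>C (su2 y \<otimes>\<^sub>K su2 (axis 1 2))) \<in> V"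
    by (intro commutator_in) (auto simp: coupling_def)
  then show "cross3 x y \<in> drift"
    by (simp add: cscale_su2_kron_commutator drift_def inner_axis_axis)
qed

lemma drift_cross: "x \<in> drift \<Longrightarrow> y \<in> coupling \<Longrightarrow> cross3 x y \<in> coupling"
  unfolding drift_def coupling_def
  using commutator_in[of "su2 x \<otimes>\<^sub>K mat 1" "\<i> *\<^sub>C (su2 y \<otimes>\<^sub>K su2 _)"]
  by (simp add: commutator_cscale_right commutator_kron_mat_1_left commutator_su2)

lemma cross_control:
  "\<i> *\<^sub>C (su2 x \<otimes>\<^sub>K su2 y) \<in> V \<Longrightarrow> \<i> *\<^sub>C (su2 x \<otimes>\<^sub>K su2 (cross3 y z)) \<in> V"
  using commutator_in[of "\<i> *\<^sub>C (su2 x \<otimes>\<^sub>K su2 y)", OF _ control[of z]]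
  by (simp add: commutator_cscale_left commutator_kron_mat_1_right commutator_su2)

text \<open>One direction of the auxiliary factor yields all of them: bracketing twice with controls
  gives \<open>cross3 (cross3 y z) y\<close>, the part of \<open>z\<close> orthogonal to
  \<open>y\<close>, and the parallel part is a multiple of \<open>y\<close>.\<close>

lemma couplingI:
  assumes "\<i> *\<^sub>C (su2 x \<otimes>\<^sub>K su2 y) \<in> V" "norm y = 1"
  shows "x \<in> coupling"
proof -
  have "\<i> *\<^sub>C (su2 x \<otimes>\<^sub>K su2 z) \<in> V" for z
  proof -
    have "z = cross3 (cross3 y z) y + (y \<bullet> z) *\<^sub>R y"
      using assms(2) cross_skew[of "cross3 y z" y]
      by (simp add: Lagrange norm_eq_1)
    then have "\<i> *\<^sub>C (su2 x \<otimes>\<^sub>K su2 z) =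
        \<i> *\<^sub>C (su2 x \<otimes>\<^sub>K su2 (cross3 (cross3 y z) y)) + (y \<bullet> z) *\<^sub>R (\<i> *\<^sub>C (su2 x \<otimes>\<^sub>K su2 y))"
      by (metis (no_types) su2_add su2_scaleR kron.add_right kron.scaleR_right
          cscale_of_real cscale_cscale mult.commute matrix_mult.add_right cscale_mat_1_mult)
    then show ?thesis
      using cross_control[OF cross_control[OF assms(1)]] assms(1) subspace
      by (simp add: subspace_add subspace_scale)
  qed
  then show ?thesis by (simp add: coupling_def)
qed

text \<open>Every bracket with a control removes the term on the system alone, and suitable double
  brackets isolate a single coupling term. Subtracting the coupling terms from the drift then leaves
  the system term.\<close>

lemma drift_term_split:
  assumes "su2 b \<otimes>\<^sub>K mat 1 + \<i> *\<^sub>C (su2 t1 \<otimes>\<^sub>K su2 (axis 1 1)) + \<i> *\<^sub>C (su2 t2 \<otimes>\<^sub>K su2 (axis 2 1)) +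
    \<i> *\<^sub>C (su2 t3 \<otimes>\<^sub>K su2 (axis 3 1)) \<in> V" (is "?N \<in> V")
  shows "{t1, t2, t3} \<subseteq> coupling" "b \<in> drift"
proof -
  have "commutator (commutator ?N (mat 1 \<otimes>\<^sub>K su2 y)) (mat 1 \<otimes>\<^sub>K su2 z) =
      \<i> *\<^sub>C (su2 t1 \<otimes>\<^sub>K su2 (cross3 (cross3 (axis 1 1) y) z)) +
      \<i> *\<^sub>C (su2 t2 \<otimes>\<^sub>K su2 (cross3 (cross3 (axis 2 1) y) z)) +
      \<i> *\<^sub>C (su2 t3 \<otimes>\<^sub>K su2 (cross3 (cross3 (axis 3 1) y) z))" for y z
    by (simp add: commutator_add_left commutator_cscale_left commutator_kron_mat_1_right
        commutator_su2 kron.zero_right)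
  with commutator_in[OF commutator_in[OF assms control] control]
  have in_V: "\<i> *\<^sub>C (su2 t1 \<otimes>\<^sub>K su2 (cross3 (cross3 (axis 1 1) y) z)) +
      \<i> *\<^sub>C (su2 t2 \<otimes>\<^sub>K su2 (cross3 (cross3 (axis 2 1) y) z)) +
      \<i> *\<^sub>C (su2 t3 \<otimes>\<^sub>K su2 (cross3 (cross3 (axis 3 1) y) z)) \<in> V" for y z
    by metis
  have zero: "\<i> *\<^sub>C 0 = (0 :: complex^(2 \<times> 2)^(2 \<times> 2))"
    by (simp add: vec_eq_iff)
  show t: "{t1, t2, t3} \<subseteq> coupling"
    \<comment> \<open>The three choices of \<open>y\<close> and \<open>z\<close> keep only
      \<open>t1\<close>, \<open>t2\<close> and \<open>t3\<close> respectively, paired with a unit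
      vector.\<close>
    using in_V[of "axis 2 1" "axis 1 1"] in_V[of "axis 1 1" "axis 2 1"] in_V[of "axis 1 1" "axis 3 1"]
    by (auto intro: couplingI simp: cross_basis su2_0 kron.zero_right zero)
  then have "\<i> *\<^sub>C (su2 t1 \<otimes>\<^sub>K su2 (axis 1 1)) \<in> V" "\<i> *\<^sub>C (su2 t2 \<otimes>\<^sub>K su2 (axis 2 1)) \<in> V"
    "\<i> *\<^sub>C (su2 t3 \<otimes>\<^sub>K su2 (axis 3 1)) \<in> V"
    by (auto simp: coupling_def)
  then have "?N - \<i> *\<^sub>C (su2 t3 \<otimes>\<^sub>K su2 (axis 3 1)) - \<i> *\<^sub>C (su2 t2 \<otimes>\<^sub>K su2 (axis 2 1)) -
      \<i> *\<^sub>C (su2 t1 \<otimes>\<^sub>K su2 (axis 1 1)) \<in> V"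
    using assms subspace by (intro subspace_diff)
  then show "b \<in> drift" by (simp add: drift_def)
qed

lemma su_subset:
  assumes "coupling = UNIV"
  shows "su \<subseteq> V"
proof (rule su_4_subset[OF subspace _ control])
  fix x y
  show "\<i> *\<^sub>C (su2 x \<otimes>\<^sub>K su2 y) \<in> V" using assms by (auto simp: coupling_def)
  have "cross3 x y \<in> drift" for x y using assms by (intro coupling_cross) auto
  from this[of "axis 2 1" "axis 3 1"] this[of "axis 3 1" "axis 1 1"] this[of "axis 1 1" "axis 2 1"]
  have "axis 1 1 \<in> drift" "axis 2 1 \<in> drift" "axis 3 1 \<in> drift" by (simp_all add: cross_basis)
  then have "x $ 1 *\<^sub>R axis 1 1 + x $ 2 *\<^sub>R axis 2 1 + x $ 3 *\<^sub>R axis 3 1 \<in> drift"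
    using subspace_drift by (intro subspace_add subspace_scale)
  also have "x $ 1 *\<^sub>R axis 1 1 + x $ 2 *\<^sub>R axis 2 1 + x $ 3 *\<^sub>R axis 3 1 = x"
    by (simp add: vec_eq_iff forall_3 axis_def)
  finally show "su2 x \<otimes>\<^sub>K mat 1 \<in> V" by (simp add: drift_def)
qed

text \<open>In the second case the coupling space is the line through \<open>c\<close> or a plane with
  normal \<open>c\<close>.\<close>

lemma coupling_cases:
  assumes S: "S \<subseteq> coupling" "t \<in> S" "t \<noteq> 0" and b: "b \<in> drift"
  obtains "coupling = UNIV"
  | c where "norm c = 1" "cross3 b c = 0" "(\<forall>x\<in>S. cross3 x c = 0) \<or> (\<forall>x\<in>S. x \<bullet> c = 0)"
proof (cases "\<forall>x\<in>coupling. cross3 t x = 0")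
  case True
  \<comment> \<open>In this case every coupling vector is parallel to \<open>t\<close>. Applied to
    \<open>cross3 b t\<close>, which is orthogonal to \<open>t\<close>, this forces \<open>b\<close>
    to be parallel to \<open>t\<close> as well, so \<open>c\<close> is \<open>t\<close>
    normalised.\<close>
  have "cross3 b t \<in> coupling" using S b drift_cross by blast
  with True have "cross3 t (cross3 b t) = 0" by blast
  then have "(t \<bullet> t) *\<^sub>R b = (t \<bullet> b) *\<^sub>R t" by (simp add: Lagrange)
  then have "(t \<bullet> t) *\<^sub>R cross3 b t = 0" by (metis cross_mult_left cross_refl scaleR_zero_right)
  then have "cross3 b t = 0" using S by simp
  moreover have "cross3 x t = 0" if "x \<in> S" for x
    using True S(1) that cross_skew[of x t] by auto
  ultimately show thesis
    using S(3) by (intro that(2)[of "(1 / norm t) *\<^sub>R t"]) (simp_all add: cross_mult_right)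
next
  case False
  then obtain x where x: "x \<in> coupling" "cross3 t x \<noteq> 0" by blast
  define n where "n = cross3 t x"
  have t: "t \<in> coupling" using S by blast
  show thesis
  proof (cases "\<exists>z\<in>coupling. z \<bullet> n \<noteq> 0")
    case True
    then obtain z where z: "z \<in> coupling" "z \<bullet> n \<noteq> 0" by blast
    have "y \<in> coupling" for y
    proof -
      \<comment> \<open>Cramer's rule for the basis \<open>t\<close>, \<open>x\<close>,
        \<open>z\<close>, whose determinant is \<open>z \<bullet> n\<close>.\<close>
      have "(z \<bullet> n) *\<^sub>R y =
          (y \<bullet> cross3 x z) *\<^sub>R t + (y \<bullet> cross3 z t) *\<^sub>R x + (y \<bullet> n) *\<^sub>R z"
        by (simp add: n_def vec_eq_iff forall_3 cross_components inner_vec_def sum_3 algebra_simps)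
      moreover have "\<dots> \<in> coupling"
        using subspace_coupling t x(1) z(1) by (intro subspace_add subspace_scale)
      ultimately have "(1 / (z \<bullet> n)) *\<^sub>R ((z \<bullet> n) *\<^sub>R y) \<in> coupling"
        using subspace_coupling by (metis subspace_scale)
      then show ?thesis using z(2) by simp
    qed
    then show thesis using that(1) by blast
  next
    case False
    \<comment> \<open>The coupling space now lies in the plane with normal \<open>n\<close>, and
      \<open>cross3 b\<close> maps it into itself.\<close>
    have "cross3 b t \<bullet> n = 0" "cross3 b x \<bullet> n = 0"
      using False drift_cross[OF b] t x(1) by auto
    then have "cross3 b n \<bullet> t = 0" "cross3 b n \<bullet> x = 0"
      by (metis cross_triple cross_skew inner_minus_left neg_equal_0_iff_equal)+
    \<comment> \<open>By the triple product expansion the second vector is again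
      \<open>cross3 b n\<close>, which is thus orthogonal to itself.\<close>
    then have "cross3 b n \<bullet> ((b \<bullet> x) *\<^sub>R t - (b \<bullet> t) *\<^sub>R x) = 0"
      by (simp add: inner_diff_right)
    then have "cross3 b n = 0" by (simp add: n_def Lagrange)
    then show thesis
      using False S(1) x(2)
      by (intro that(2)[of "(1 / norm n) *\<^sub>R n"])
         (auto simp: cross_mult_right n_def)
  qed
qed

end

section \<open>The obstruction\<close>

definition cnj_matrix :: "complex^'n^'m \<Rightarrow> complex^'n^'m"
  where "cnj_matrix A = (\<chi> i j. cnj (A $ i $ j))"

lemma cnj_matrix_nth [simp]: "cnj_matrix A $ i $ j = cnj (A $ i $ j)"
  by (simp add: cnj_matrix_def)

lemma bounded_linear_cnj_matrix: "bounded_linear (cnj_matrix :: complex^'n^'m \<Rightarrow> complex^'n^'m)"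
  unfolding linear_conv_bounded_linear[symmetric]
  by (auto intro!: linearI simp: vec_eq_iff)

lemma cnj_matrix_mult: "cnj_matrix (A ** B) = cnj_matrix A ** cnj_matrix B"
  by (simp add: vec_eq_iff matrix_mult_nth)

lemma cnj_matrix_mat_1: "cnj_matrix (mat 1) = mat 1"
  by (simp add: vec_eq_iff mat_def)

lemma cnj_matrix_kron: "cnj_matrix (P \<otimes>\<^sub>K Q) = cnj_matrix P \<otimes>\<^sub>K cnj_matrix Q"
  by (simp add: vec_eq_iff)

lemma cnj_matrix_cscale: "cnj_matrix (c *\<^sub>C A) = cnj c *\<^sub>C cnj_matrix A"
  by (simp add: vec_eq_iff)

lemma trace_cnj_matrix: "trace (cnj_matrix A) = cnj (trace A)"
  by (simp add: trace_def)

text \<open>The defining representation of \<open>su(2)\<close> is equivalent to its conjugate, with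
  \<open>sigma_y\<close> as intertwiner.\<close>

lemma cnj_su2_sigma_y: "cnj_matrix (su2 x) ** sigma_y = sigma_y ** su2 x"
  unfolding su2_eq_sigma[symmetric]
  by (simp add: vec_eq_iff forall_2 matrix_mult_nth sum_2 su2_nth axis_def complex_eq_iff)

text \<open>Below \<open>h\<close> is the identity or complex conjugation, so that \<open>h X ** M = M ** X\<close> says
  that \<open>X\<close> commutes with a linear or an antilinear map of \<open>\<complex>\<^sup>4\<close>.\<close>

locale symmetry =
  fixes h :: "complex^'n^'n \<Rightarrow> complex^'n^'n" and M M' :: "complex^'n^'n"
  assumes bounded_linear: "bounded_linear h"
    and h_one: "h (mat 1) = mat 1" and h_mult: "h (A ** B) = h A ** h B"
    and trace_h: "Im (trace A) = 0 \<Longrightarrow> trace (h A) = trace A"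
    and inverse: "M ** M' = mat 1"
begin

interpretation h: bounded_linear h
  by (rule bounded_linear)

text \<open>The scalar \<open>r\<close> is \<open>1\<close> for commutation and \<open>-1\<close>
  for anticommutation.\<close>

lemma h_mult_commute:
  assumes "h A ** M = r *\<^sub>R (M ** A)" "h B ** M = M ** B"
  shows "h (A ** B) ** M = r *\<^sub>R (M ** (A ** B))"
proof -
  have "h (A ** B) ** M = h A ** (h B ** M)"
    by (simp add: h_mult matrix_mul_assoc)
  also have "\<dots> = (h A ** M) ** B"
    by (simp add: assms(2) matrix_mul_assoc)
  also have "\<dots> = r *\<^sub>R (M ** (A ** B))"
    unfolding assms(1) by (simp add: matrix_mult.scaleR_left matrix_mul_assoc)
  finally show ?thesis .
qed

lemma real_lie_algebra_commutant: "real_lie_algebra {A. h A ** M = M ** A}"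
  unfolding real_lie_algebra_def
proof (intro conjI ballI)
  show "subspace {A. h A ** M = M ** A}"
    by (auto intro!: subspaceI simp: h.zero h.add h.scaleR matrix_mult.add_left matrix_mult.add_right
        matrix_mult.scaleR_left matrix_mult.scaleR_right)
  fix X Y assume "X \<in> {A. h A ** M = M ** A}" "Y \<in> {A. h A ** M = M ** A}"
  then have X: "h X ** M = M ** X" and Y: "h Y ** M = M ** Y" by auto
  show "commutator X Y \<in> {A. h A ** M = M ** A}"
    using h_mult_commute[of X 1 Y] h_mult_commute[of Y 1 X] X Y
    by (simp add: commutator_def h.diff matrix_mult.diff_left matrix_mult.diff_right)
qed

lemma lie_group_commutant:
  assumes "X \<in> lie_group V" "V \<subseteq> {A. h A ** M = M ** A}"
  shows "h X ** M = M ** X"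
  using assms(1)
proof induction
  case (exp_mult A X)
  then have "M ** A = h A ** M" using assms(2) by auto
  then have "M ** matrix_exp A = h (matrix_exp A) ** M"
    by (simp add: matrix_exp_hom[OF bounded_linear h_one h_mult] matrix_exp_intertwine)
  then show ?case using h_mult_commute[of "matrix_exp A" 1 X] exp_mult.IH by simp
qed (simp add: h_one)

text \<open>The orbit of \<open>P\<close> stays in the commutant while \<open>Q\<close>
  anticommutes, so \<open>h\<close> of the product is minus a conjugate of the product, and its
  trace changes sign. The trace of a product of two skew-Hermitian matrices is real, hence preserved
  by \<open>h\<close>, and must vanish.\<close>

lemma trace_orbit_eq_0:
  assumes X: "X \<in> lie_group V" and V: "V \<subseteq> {A. h A ** M = M ** A}" "V \<subseteq> skew_hermitian"
    and P: "dagger P = - P" "h P ** M = M ** P"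
    and Q: "dagger Q = - Q" "h Q ** M = - (M ** Q)"
  shows "trace (Q ** (X ** P ** dagger X)) = 0"
proof -
  have hX: "h X ** M = M ** X" by (rule lie_group_commutant[OF X V(1)])
  have U: "dagger X ** X = mat 1" "X ** dagger X = mat 1"
    using unitary_lie_group[OF X V(2)] by (simp_all add: unitary_def)
  \<comment> \<open>The commutation relation passes from \<open>X\<close> to its inverse.\<close>
  have "h (dagger X) ** M = h (dagger X) ** (M ** (X ** dagger X))"
    by (simp add: U)
  also have "\<dots> = h (dagger X) ** (M ** X) ** dagger X"
    by (simp add: matrix_mul_assoc)
  also have "\<dots> = h (dagger X ** X) ** M ** dagger X"
    unfolding hX[symmetric] by (simp add: h_mult matrix_mul_assoc)
  finally have hX': "h (dagger X) ** M = M ** dagger X"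
    by (simp add: U h_one)
  define Y where "Y = X ** P ** dagger X"
  have "h Y ** M = M ** Y"
    unfolding Y_def using h_mult_commute[of X 1 P] h_mult_commute[of "X ** P" 1 "dagger X"] hX hX' P(2)
    by simp
  then have QY: "h (Q ** Y) ** M = - (M ** (Q ** Y))"
    using h_mult_commute[of Q "-1" Y] Q(2) by simp
  have "h (Q ** Y) = h (Q ** Y) ** M ** M'"
    by (simp add: inverse flip: matrix_mul_assoc)
  then have "trace (h (Q ** Y)) = - trace (M ** (Q ** Y) ** M')"
    unfolding QY by (simp add: matrix_mult.minus_left trace_minus)
  also have "\<dots> = - trace (M' ** M ** (Q ** Y))"
    by (subst trace_mult_cycle) simp
  finally have "trace (h (Q ** Y)) = - trace (M' ** M ** (Q ** Y))" .
  moreover have "M' ** M = mat 1" using inverse matrix_left_right_inverse by blast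
  moreover have "dagger Y = - Y"
    by (simp add: Y_def dagger_mult P(1) matrix_mult.minus_left matrix_mult.minus_right matrix_mul_assoc)
  have "trace (Y ** Q) = trace (Q ** Y)" by (rule trace_mul_sym)
  with \<open>dagger Y = - Y\<close> have "cnj (trace (Q ** Y)) = trace (Q ** Y)"
    by (simp add: dagger_mult Q(1) matrix_mult.minus_left matrix_mult.minus_right
        flip: trace_dagger)
  then have "Im (trace (Q ** Y)) = 0" by (simp add: complex_eq_iff)
  ultimately show ?thesis
    using trace_h[of "Q ** Y"] by (simp add: Y_def)
qed

end

section \<open>The two symmetries of the model\<close>

lemma su2_square: "norm x = 1 \<Longrightarrow> su2 x ** su2 x = - (1 / 4) *\<^sub>R mat 1"
  by (simp add: su2_mult su2_0 norm_eq_1)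

lemma su2_commute: "cross3 x y = 0 \<Longrightarrow> su2 x ** su2 y = su2 y ** su2 x"
  using cross_skew[of x y] by (simp add: su2_mult su2_0 inner_commute)

lemma su2_anticommute: "x \<bullet> y = 0 \<Longrightarrow> su2 x ** su2 y = - (su2 y ** su2 x)"
  using cross_skew[of x y] by (simp add: su2_mult su2_minus inner_commute)

lemma exists_unit_orthogonal:
  fixes c :: "real^3"
  assumes "norm c = 1"
  obtains a where "norm a = 1" "a \<bullet> c = 0"
proof -
  have "c \<noteq> 0" using assms by auto
  then obtain k where k: "cross3 c (axis k 1) \<noteq> 0" using cross_basis_nonzero by blast
  show thesis
    by (rule that[of "(1 / norm (cross3 c (axis k 1))) *\<^sub>R cross3 c (axis k 1)"])
       (use k in \<open>auto simp: dot_cross_self inner_commute\<close>)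
qed

lemma symmetry_commuting:
  assumes "norm c = 1"
  shows "symmetry id (su2 c \<otimes>\<^sub>K mat 1) (- 4 *\<^sub>R (su2 c \<otimes>\<^sub>K mat 1))"
  by (intro symmetry.intro)
     (simp_all add: bounded_linear_ident id_def matrix_mult.scaleR_right matrix_mult.minus_right
       kron_mult su2_square assms kron.minus_left kron.scaleR_left kron_mat_1)

text \<open>Without \<open>su2 c\<close> this would be the spin flip of both qubits. The constant
  \<open>-64\<close> comes from three squares, each equal to \<open>-1/4\<close>.\<close>

lemma symmetry_antiunitary:
  assumes "norm c = 1"
  shows "symmetry cnj_matrix ((sigma_y ** su2 c) \<otimes>\<^sub>K sigma_y) (- 64 *\<^sub>R ((su2 c ** sigma_y) \<otimes>\<^sub>K sigma_y))"
proof (intro symmetry.intro bounded_linear_cnj_matrix cnj_matrix_mat_1 cnj_matrix_mult)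
  have "sigma_y ** sigma_y = - (1 / 4) *\<^sub>R mat 1"
    unfolding su2_eq_sigma[symmetric] by (rule su2_square) simp
  moreover have "sigma_y ** su2 c ** (su2 c ** sigma_y) = sigma_y ** (su2 c ** su2 c) ** sigma_y"
    by (simp add: matrix_mul_assoc)
  ultimately show "((sigma_y ** su2 c) \<otimes>\<^sub>K sigma_y) ** (- 64 *\<^sub>R ((su2 c ** sigma_y) \<otimes>\<^sub>K sigma_y)) = mat 1"
    by (simp add: su2_square assms matrix_mult.scaleR_right matrix_mult.minus_right
        matrix_mult.scaleR_left matrix_mult.minus_left
        kron_mult kron.minus_left kron.scaleR_left kron.minus_right kron.scaleR_right kron_mat_1)
  show "trace (cnj_matrix A) = trace A" if "Im (trace A) = 0" for A :: "complex^(2 \<times> 2)^(2 \<times> 2)"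
    using that by (simp add: trace_cnj_matrix complex_eq_iff)
qed

text \<open>Terms on the system inherit the sign with which \<open>su2 x\<close> passes
  \<open>su2 c\<close>; conjugating \<open>\<i>\<close> adds one more sign to coupling terms. So the
  commutant contains system terms parallel to \<open>c\<close> and coupling terms orthogonal to
  \<open>c\<close>.\<close>

lemma antiunitary_symmetry_kron:
  assumes "su2 x ** su2 c = r *\<^sub>R (su2 c ** su2 x)"
  shows "cnj_matrix (su2 x \<otimes>\<^sub>K mat 1) ** ((sigma_y ** su2 c) \<otimes>\<^sub>K sigma_y) =
      r *\<^sub>R (((sigma_y ** su2 c) \<otimes>\<^sub>K sigma_y) ** (su2 x \<otimes>\<^sub>K mat 1))"
    and "cnj_matrix (\<i> *\<^sub>C (su2 x \<otimes>\<^sub>K su2 y)) ** ((sigma_y ** su2 c) \<otimes>\<^sub>K sigma_y) =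
      - r *\<^sub>R (((sigma_y ** su2 c) \<otimes>\<^sub>K sigma_y) ** (\<i> *\<^sub>C (su2 x \<otimes>\<^sub>K su2 y)))"
proof -
  have "cnj_matrix (su2 x) ** (sigma_y ** su2 c) = r *\<^sub>R (sigma_y ** su2 c ** su2 x)"
    by (simp add: matrix_mul_assoc cnj_su2_sigma_y)
       (simp flip: matrix_mul_assoc add: assms matrix_mult.scaleR_right)
  then show "cnj_matrix (su2 x \<otimes>\<^sub>K mat 1) ** ((sigma_y ** su2 c) \<otimes>\<^sub>K sigma_y) =
      r *\<^sub>R (((sigma_y ** su2 c) \<otimes>\<^sub>K sigma_y) ** (su2 x \<otimes>\<^sub>K mat 1))"
    "cnj_matrix (\<i> *\<^sub>C (su2 x \<otimes>\<^sub>K su2 y)) ** ((sigma_y ** su2 c) \<otimes>\<^sub>K sigma_y) =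
      - r *\<^sub>R (((sigma_y ** su2 c) \<otimes>\<^sub>K sigma_y) ** (\<i> *\<^sub>C (su2 x \<otimes>\<^sub>K su2 y)))"
    by (simp_all add: cnj_matrix_kron cnj_matrix_cscale cnj_matrix_mat_1 kron_mult kron.scaleR_left
        cscale_matrix_mult_left cscale_matrix_mult_right cscale_minus_left matrix_mult.minus_left
        cnj_su2_sigma_y)
       (simp_all add: vec_eq_iff)
qed

text \<open>A certificate that Bloch vectors along \<open>c\<close> cannot be turned towards
  \<open>a\<close> when the auxiliary state is maximally mixed.\<close>

definition obstructed :: "(complex^(2 \<times> 2)^(2 \<times> 2)) set \<Rightarrow> real^3 \<Rightarrow> real^3 \<Rightarrow> bool"
  where "obstructed G a c \<longleftrightarrow> norm a = 1 \<and> norm c = 1 \<and> a \<bullet> c = 0 \<and>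
    (\<forall>X\<in>G. trace ((su2 a \<otimes>\<^sub>K mat 1) ** (X ** (su2 c \<otimes>\<^sub>K mat 1) ** dagger X)) = 0)"

lemma dynamical_lie_algebra_cases:
  fixes b q t1 t2 t3 :: "real^3"
  defines "N \<equiv> su2 b \<otimes>\<^sub>K mat 1 + \<i> *\<^sub>C (su2 t1 \<otimes>\<^sub>K su2 (axis 1 1)) + \<i> *\<^sub>C (su2 t2 \<otimes>\<^sub>K su2 (axis 2 1)) +
    \<i> *\<^sub>C (su2 t3 \<otimes>\<^sub>K su2 (axis 3 1))"
  defines "V \<equiv> lie_generated (insert (N + mat 1 \<otimes>\<^sub>K su2 q) (range (\<lambda>y. mat 1 \<otimes>\<^sub>K su2 y)))"
  assumes "\<not> (t1 = 0 \<and> t2 = 0 \<and> t3 = 0)"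
  shows "V = su \<or> (\<exists>a c. obstructed (lie_group V) a c)"
proof -
  have gen: "N + mat 1 \<otimes>\<^sub>K su2 q \<in> V" "mat 1 \<otimes>\<^sub>K su2 y \<in> V" for y
    using lie_generated_superset[of "insert (N + mat 1 \<otimes>\<^sub>K su2 q) (range (\<lambda>y. mat 1 \<otimes>\<^sub>K su2 y))"]
    unfolding V_def[symmetric] by auto
  interpret locally_controlled V
  proof
    show "real_lie_algebra V" unfolding V_def by (rule real_lie_algebra_lie_generated)
  qed (rule gen(2))
  \<comment> \<open>The drift of the auxiliary system is itself a control and can be
    subtracted.\<close>
  have "N + mat 1 \<otimes>\<^sub>K su2 q - mat 1 \<otimes>\<^sub>K su2 q \<in> V"
    using subspace gen by (intro subspace_diff)
  then have N: "N \<in> V" by simp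
  note split = drift_term_split[OF N[unfolded N_def]]
  \<comment> \<open>Membership in a commutant, or in \<open>su\<close>, thus has to be checked only
    on the separate terms of the generators.\<close>
  have V_subset: "V \<subseteq> W"
    if "real_lie_algebra W" "su2 b \<otimes>\<^sub>K mat 1 \<in> W" "\<And>y. mat 1 \<otimes>\<^sub>K su2 y \<in> W"
      "\<And>t y. t \<in> {t1, t2, t3} \<Longrightarrow> \<i> *\<^sub>C (su2 t \<otimes>\<^sub>K su2 y) \<in> W" for W
  proof -
    have W: "subspace W" using that(1) by (simp add: real_lie_algebra_def)
    have "N + mat 1 \<otimes>\<^sub>K su2 q \<in> W"
      unfolding N_def by (intro subspace_add W that(2-4)) simp_all
    with that(3) have "insert (N + mat 1 \<otimes>\<^sub>K su2 q) (range (\<lambda>y. mat 1 \<otimes>\<^sub>K su2 y)) \<subseteq> W"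
      by blast
    then show ?thesis
      unfolding V_def using that(1) by (rule lie_generated_minimal)
  qed
  have V_su: "V \<subseteq> su"
    by (rule V_subset[OF real_lie_algebra_su])
       (simp_all add: su_def dagger_kron dagger_cscale dagger_su2 trace_cscale trace_kron trace_su2
         kron.minus_left kron.minus_right cscale_minus_left)
  obtain t where t: "t \<in> {t1, t2, t3}" "t \<noteq> 0" using assms(3) by blast
  from coupling_cases[OF split(1) t split(2)] show ?thesis
  proof cases
    case 1
    then show ?thesis using V_su su_subset by blast
  next
    case (2 c)
    obtain a where a: "norm a = 1" "a \<bullet> c = 0"
      using exists_unit_orthogonal[OF 2(1)] by blast
    have dagger: "dagger (su2 x \<otimes>\<^sub>K mat 1) = - (su2 x \<otimes>\<^sub>K mat 1)" for x
      by (simp add: dagger_kron dagger_su2 kron.minus_left)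
    have V_skew: "V \<subseteq> skew_hermitian"
      using V_su su_subset_skew_hermitian by blast
    have "obstructed (lie_group V) a c"
      using 2(3)
    proof
      assume t: "\<forall>x\<in>{t1, t2, t3}. cross3 x c = 0"
      interpret symmetry id "su2 c \<otimes>\<^sub>K mat 1" "- 4 *\<^sub>R (su2 c \<otimes>\<^sub>K mat 1)"
        by (rule symmetry_commuting[OF 2(1)])
      have "V \<subseteq> {A. id A ** (su2 c \<otimes>\<^sub>K mat 1) = (su2 c \<otimes>\<^sub>K mat 1) ** A}"
      proof (rule V_subset[OF real_lie_algebra_commutant])
        show "\<i> *\<^sub>C (su2 x \<otimes>\<^sub>K su2 y) \<in> {A. id A ** (su2 c \<otimes>\<^sub>K mat 1) = (su2 c \<otimes>\<^sub>K mat 1) ** A}"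
          if "x \<in> {t1, t2, t3}" for x y
        proof -
          have "cross3 x c = 0" using t that by blast
          from su2_commute[OF this] show ?thesis
            by (simp add: kron_mult cscale_matrix_mult_left cscale_matrix_mult_right)
        qed
      qed (simp_all add: kron_mult su2_commute[OF 2(2)])
      then show ?thesis
        unfolding obstructed_def
        using 2(1) a trace_orbit_eq_0[OF _ _ V_skew dagger _ dagger]
        by (simp add: kron_mult su2_anticommute[OF a(2)] kron.minus_left)
    next
      assume t: "\<forall>x\<in>{t1, t2, t3}. x \<bullet> c = 0"
      let ?J = "(sigma_y ** su2 c) \<otimes>\<^sub>K sigma_y"
      interpret symmetry cnj_matrix ?J "- 64 *\<^sub>R ((su2 c ** sigma_y) \<otimes>\<^sub>K sigma_y)"
        by (rule symmetry_antiunitary[OF 2(1)])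
      have "V \<subseteq> {A. cnj_matrix A ** ?J = ?J ** A}"
      proof (rule V_subset[OF real_lie_algebra_commutant])
        show "su2 b \<otimes>\<^sub>K mat 1 \<in> {A. cnj_matrix A ** ?J = ?J ** A}"
          using antiunitary_symmetry_kron(1)[of b c 1] su2_commute[OF 2(2)] by simp
        show "mat 1 \<otimes>\<^sub>K su2 y \<in> {A. cnj_matrix A ** ?J = ?J ** A}" for y
          by (simp add: cnj_matrix_kron kron_mult cnj_matrix_mat_1 cnj_su2_sigma_y)
        show "\<i> *\<^sub>C (su2 x \<otimes>\<^sub>K su2 y) \<in> {A. cnj_matrix A ** ?J = ?J ** A}" if "x \<in> {t1, t2, t3}" for x y
        proof -
          have "x \<bullet> c = 0" using t that by blast
          from su2_anticommute[OF this] show ?thesis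
            using antiunitary_symmetry_kron(2)[of x c "-1" y] by simp
        qed
      qed
      moreover have "cnj_matrix (su2 c \<otimes>\<^sub>K mat 1) ** ?J = ?J ** (su2 c \<otimes>\<^sub>K mat 1)"
        using antiunitary_symmetry_kron(1)[of c c 1] by simp
      moreover have "cnj_matrix (su2 a \<otimes>\<^sub>K mat 1) ** ?J = - (?J ** (su2 a \<otimes>\<^sub>K mat 1))"
        using antiunitary_symmetry_kron(1)[of a c "-1"] su2_anticommute[OF a(2)] by simp
      ultimately show ?thesis
        unfolding obstructed_def using 2(1) a trace_orbit_eq_0[OF _ _ V_skew dagger _ dagger] by blast
    qed
    then show ?thesis by blast
  qed
qed

section \<open>Indirect controllability\<close>

text \<open>The explicit condition (i), stated for an arbitrary set \<open>G\<close> of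
  evolutions.\<close>

definition indirectly_controllable :: "(complex^(2 \<times> 2)^(2 \<times> 2)) set \<Rightarrow> bool"
  where "indirectly_controllable G \<longleftrightarrow>
    (\<forall>\<rho>S \<rho>A X\<^sub>S. density_matrix \<rho>S \<longrightarrow> density_matrix \<rho>A \<longrightarrow> X\<^sub>S \<in> SU \<longrightarrow>
      (\<exists>X\<in>G. ptrace_A (X ** (\<rho>S \<otimes>\<^sub>K \<rho>A) ** dagger X) = X\<^sub>S ** \<rho>S ** dagger X\<^sub>S))"

section \<open>Density matrices and local unitaries\<close>

lemma density_matrix_dagger_mult:
  assumes "trace (dagger A ** A) = 1"
  shows "density_matrix (dagger A ** A)"
proof -
  have "(\<Sum>i\<in>UNIV. cnj (v $ i) * ((dagger A ** A) *v v) $ i) =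
      (\<Sum>k\<in>UNIV. cnj ((A *v v) $ k) * (A *v v) $ k)" for v
  proof -
    have "(\<Sum>i\<in>UNIV. cnj (v $ i) * ((dagger A ** A) *v v) $ i) =
        (\<Sum>i\<in>UNIV. \<Sum>k\<in>UNIV. cnj (v $ i) * (cnj (A $ k $ i) * (A *v v) $ k))"
      unfolding matrix_vector_mul_assoc[symmetric]
      by (simp add: matrix_vector_mult_def[of "dagger A"] sum_distrib_left)
    also have "\<dots> = (\<Sum>k\<in>UNIV. \<Sum>i\<in>UNIV. cnj (v $ i) * (cnj (A $ k $ i) * (A *v v) $ k))"
      by (rule sum.swap)
    also have "\<dots> = (\<Sum>k\<in>UNIV. cnj ((A *v v) $ k) * (A *v v) $ k)"
    proof (rule sum.cong[OF refl])
      fix k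
      have "cnj ((A *v v) $ k) = (\<Sum>i\<in>UNIV. cnj (v $ i) * cnj (A $ k $ i))"
        by (simp add: matrix_vector_mult_def mult.commute)
      then show "(\<Sum>i\<in>UNIV. cnj (v $ i) * (cnj (A $ k $ i) * (A *v v) $ k)) =
          cnj ((A *v v) $ k) * (A *v v) $ k"
        by (simp add: sum_distrib_right mult.assoc)
    qed
    finally show ?thesis .
  qed
  then show ?thesis
    using assms
    by (simp add: density_matrix_def pos_semidef_def hermitian_def dagger_mult sum_cnj_mult_self
        sum_nonneg del: of_real_sum)
qed

lemma density_matrix_unitary:
  assumes \<rho>: "density_matrix \<rho>" and U: "unitary U"
  shows "density_matrix (U ** \<rho> ** dagger U)"
proof -
  have adj: "(\<Sum>i\<in>UNIV. cnj (v $ i) * (U *v w) $ i) = (\<Sum>k\<in>UNIV. cnj ((dagger U *v v) $ k) * w $ k)" for v w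
    by (simp add: matrix_vector_mult_def sum_distrib_left sum_distrib_right)
       (subst sum.swap, simp add: mult_ac)
  have "0 \<le> Re (\<Sum>i\<in>UNIV. cnj (v $ i) * ((U ** \<rho> ** dagger U) *v v) $ i)" for v
    using \<rho> adj[of v "\<rho> *v (dagger U *v v)"]
    by (simp add: density_matrix_def pos_semidef_def flip: matrix_vector_mul_assoc)
  moreover have "trace (U ** \<rho> ** dagger U) = trace (dagger U ** U ** \<rho>)"
    by (rule trace_mult_cycle)
  ultimately show ?thesis
    using \<rho> U
    by (simp add: density_matrix_def pos_semidef_def hermitian_def dagger_mult unitary_def matrix_mul_assoc)
qed

text \<open>Writing \<open>X\<close> as a product of exponentials replaces the determinant of a
  tensor product by the trace of one.\<close>

lemma kron_mat_1_SU:
  fixes X :: "complex^'a^'a"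
  assumes "X \<in> SU"
  shows "X \<otimes>\<^sub>K (mat 1 :: complex^'c^'c) \<in> SU"
proof -
  have "X \<in> lie_group su" using assms lie_group_su by blast
  then have "X \<otimes>\<^sub>K (mat 1 :: complex^'c^'c) \<in> lie_group su"
  proof induction
    case (exp_mult A X)
    have "matrix_exp A \<otimes>\<^sub>K (mat 1 :: complex^'c^'c) = matrix_exp (A \<otimes>\<^sub>K mat 1)"
      by (rule matrix_exp_hom[OF kron.bounded_linear_left]) (simp_all add: kron_mat_1 kron_mult)
    moreover have "A \<otimes>\<^sub>K (mat 1 :: complex^'c^'c) \<in> su"
      using exp_mult.hyps(1) by (simp add: su_def dagger_kron trace_kron kron.minus_left)
    moreover have "(matrix_exp A ** X) \<otimes>\<^sub>K (mat 1 :: complex^'c^'c) =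
        (matrix_exp A \<otimes>\<^sub>K mat 1) ** (X \<otimes>\<^sub>K mat 1)"
      by (simp add: kron_mult)
    ultimately show ?case
      using lie_group.exp_mult[OF _ exp_mult.IH] by simp
  qed (simp add: kron_mat_1 lie_group.one)
  then show ?thesis using lie_group_su by blast
qed

lemma SU_imp_indirectly_controllable:
  assumes "SU \<subseteq> G"
  shows "indirectly_controllable G"
  unfolding indirectly_controllable_def
proof (intro allI impI)
  fix \<rho>S \<rho>A X\<^sub>S :: "complex^2^2"
  assume \<rho>: "density_matrix \<rho>A" and X: "X\<^sub>S \<in> SU"
  have "ptrace_A ((X\<^sub>S \<otimes>\<^sub>K mat 1) ** (\<rho>S \<otimes>\<^sub>K \<rho>A) ** dagger (X\<^sub>S \<otimes>\<^sub>K mat 1)) = X\<^sub>S ** \<rho>S ** dagger X\<^sub>S"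
    using \<rho> by (simp add: kron_mult dagger_kron ptrace_A_kron density_matrix_def)
  moreover have "X\<^sub>S \<otimes>\<^sub>K mat 1 \<in> G" using assms kron_mat_1_SU[OF X] by blast
  ultimately show "\<exists>X\<in>G. ptrace_A (X ** (\<rho>S \<otimes>\<^sub>K \<rho>A) ** dagger X) = X\<^sub>S ** \<rho>S ** dagger X\<^sub>S"
    by blast
qed

text \<open>Length two makes \<open>su2 w\<close> a unit pure quaternion.\<close>

lemma su2_in_SU: "norm w = 2 \<Longrightarrow> su2 w \<in> SU"
proof -
  assume w: "norm w = 2"
  then have "w \<bullet> w = 4" by (simp add: dot_square_norm)
  then have "su2 w ** su2 w = - mat 1" by (simp add: su2_mult su2_0)
  moreover have "det (su2 w) = of_real (w \<bullet> w) / 4"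
    by (simp add: det_2 su2_nth inner_vec_def sum_3 complex_eq_iff field_simps)
  ultimately show ?thesis
    using \<open>w \<bullet> w = 4\<close>
    by (simp add: SU_def unitary_def dagger_su2 matrix_mult.minus_left matrix_mult.minus_right)
qed

text \<open>The half turn about the bisector of \<open>a\<close> and \<open>c\<close> exchanges
  them; the factor \<open>sqrt 2\<close> gives \<open>w\<close> length two.\<close>

lemma su2_half_turn:
  assumes "norm a = 1" "norm c = 1" "a \<bullet> c = 0"
  defines "w \<equiv> sqrt 2 *\<^sub>R (a + c)"
  shows "su2 w \<in> SU" "su2 w ** su2 c ** dagger (su2 w) = su2 a"
proof -
  have ac: "a \<bullet> a = 1" "c \<bullet> c = 1" "c \<bullet> a = 0"
    using assms by (simp_all add: norm_eq_1 inner_commute)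
  have ww: "w \<bullet> w = 4" and wc: "w \<bullet> c = sqrt 2"
    using ac assms(3) by (simp_all add: w_def inner_add_left inner_add_right algebra_simps)
  have "norm w = 2" using ww by (simp add: norm_eq_sqrt_inner)
  then show "su2 w \<in> SU" by (rule su2_in_SU)
  have "cross3 (cross3 w c) w = 4 *\<^sub>R c - sqrt 2 *\<^sub>R w"
    using cross_skew[of "cross3 w c" w] by (simp add: Lagrange ww wc)
  then have cross: "su2 (cross3 (cross3 w c) w) = 4 *\<^sub>R su2 c - sqrt 2 *\<^sub>R su2 w"
    by (simp add: su2_diff su2_scaleR)
  have "su2 w ** su2 c ** su2 w =
      (1 / 2) *\<^sub>R (1 / 2) *\<^sub>R su2 (cross3 (cross3 w c) w) - (sqrt 2 / 4) *\<^sub>R su2 w"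
    by (simp add: su2_mult[of w c] matrix_mult.diff_left matrix_mult.scaleR_left su2_mult
        dot_cross_self wc)
  also have "\<dots> = su2 (c - (sqrt 2 / 2) *\<^sub>R w)"
    unfolding cross by (simp add: su2_diff su2_scaleR vec_eq_iff scaleR_conv_of_real[where 'a = complex] algebra_simps)
  also have "c - (sqrt 2 / 2) *\<^sub>R w = - a"
    by (simp add: w_def algebra_simps)
  finally show "su2 w ** su2 c ** dagger (su2 w) = su2 a"
    by (simp add: dagger_su2 su2_minus matrix_mult.minus_right)
qed

lemma obstructed_imp_not_indirectly_controllable:
  assumes "obstructed (lie_group V) a c" "V \<subseteq> skew_hermitian"
  shows "\<not> indirectly_controllable (lie_group V)"
proof
  assume ctrl: "indirectly_controllable (lie_group V)"
  note ac = assms(1)[unfolded obstructed_def]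
  obtain S where S: "S \<in> SU" "S ** su2 c ** dagger S = su2 a"
    using su2_half_turn ac by blast
  \<comment> \<open>A pure state along \<open>c\<close>: being a Hermitian idempotent, it equals
    \<open>dagger \<rho>S ** \<rho>S\<close>.\<close>
  define \<rho>S where "\<rho>S = (1 / 2) *\<^sub>R mat 1 + \<i> *\<^sub>C su2 c"
  define \<rho>A :: "complex^2^2" where "\<rho>A = (1 / 2) *\<^sub>R mat 1"
  have "dagger \<rho>S = \<rho>S"
    by (simp add: \<rho>S_def dagger_add dagger_scaleR dagger_cscale dagger_su2 cscale_minus_left)
       (simp add: vec_eq_iff)
  moreover have "\<rho>S ** \<rho>S = \<rho>S"
    using ac by (simp add: \<rho>S_def matrix_mult.add_left matrix_mult.add_right matrix_mult.scaleR_left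
        matrix_mult.scaleR_right cscale_matrix_mult_left cscale_matrix_mult_right su2_square)
      (simp add: vec_eq_iff scaleR_conv_of_real[where 'a = complex] field_simps)
  moreover have "trace \<rho>S = 1"
    by (simp add: \<rho>S_def trace_add trace_scaleR trace_I trace_cscale trace_su2)
  ultimately have \<rho>S: "density_matrix \<rho>S"
    using density_matrix_dagger_mult[of \<rho>S] by simp
  define r :: "complex^2^2" where "r = (1 / sqrt 2) *\<^sub>R mat 1"
  have "dagger r ** r = \<rho>A"
    by (simp add: r_def \<rho>A_def dagger_scaleR matrix_mult.scaleR_left matrix_mult.scaleR_right)
  then have \<rho>A: "density_matrix \<rho>A"
    using density_matrix_dagger_mult[of r] by (simp add: \<rho>A_def trace_scaleR trace_I)
  obtain X where X: "X \<in> lie_group V"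
    "ptrace_A (X ** (\<rho>S \<otimes>\<^sub>K \<rho>A) ** dagger X) = S ** \<rho>S ** dagger S"
    using ctrl \<rho>S \<rho>A S(1) unfolding indirectly_controllable_def by blast
  have XX: "X ** dagger X = mat 1" and SS: "S ** dagger S = mat 1"
    using unitary_lie_group[OF X(1) assms(2)] S(1) by (simp_all add: unitary_def SU_def)
  \<comment> \<open>The maximally mixed auxiliary state makes the joint state a scalar, which
    conjugation fixes, plus a multiple of \<open>su2 c \<otimes>\<^sub>K mat 1\<close>, whose orbit
    is controlled by the obstruction.\<close>
  have "\<rho>S \<otimes>\<^sub>K \<rho>A = (1 / 4) *\<^sub>R mat 1 + (\<i> / 2) *\<^sub>C (su2 c \<otimes>\<^sub>K mat 1)"
    by (simp add: \<rho>S_def \<rho>A_def kron.add_left kron.scaleR_left kron.scaleR_right kron_cscale_left kron_mat_1)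
       (simp add: vec_eq_iff scaleR_conv_of_real[where 'a = complex])
  then have "trace ((su2 a \<otimes>\<^sub>K mat 1) ** (X ** (\<rho>S \<otimes>\<^sub>K \<rho>A) ** dagger X)) =
      (1 / 4) * trace (su2 a \<otimes>\<^sub>K (mat 1 :: complex^2^2)) +
      (\<i> / 2) * trace ((su2 a \<otimes>\<^sub>K mat 1) ** (X ** (su2 c \<otimes>\<^sub>K mat 1) ** dagger X))"
    by (simp add: matrix_mult.add_left matrix_mult.add_right matrix_mult.scaleR_left
        matrix_mult.scaleR_right cscale_matrix_mult_left cscale_matrix_mult_right XX
        trace_add trace_scaleR trace_cscale)
  also have "\<dots> = 0"
    using ac X(1) by (simp add: trace_kron trace_su2)
  finally have "trace (su2 a ** (S ** \<rho>S ** dagger S)) = 0"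
    by (simp add: trace_mult_ptrace_A flip: X(2))
  moreover have "S ** \<rho>S ** dagger S = (1 / 2) *\<^sub>R mat 1 + \<i> *\<^sub>C su2 a"
    by (simp add: \<rho>S_def matrix_mult.add_left matrix_mult.add_right matrix_mult.scaleR_left
        matrix_mult.scaleR_right cscale_matrix_mult_left cscale_matrix_mult_right SS S(2))
  \<comment> \<open>For this target the trace would be \<open>- \<i> / 2\<close>.\<close>
  ultimately show False
    using ac by (simp add: matrix_mult.add_right matrix_mult.scaleR_right cscale_matrix_mult_right
        trace_add trace_scaleR trace_cscale trace_su2 trace_su2_mult norm_eq_1)
qed

text \<open>Dividing by a square root of the determinant changes \<open>U\<close> by a phase, which
  cancels in the conjugation.\<close>

lemma unitary_2_conjugation:
  fixes U :: "complex^2^2"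
  assumes "unitary U"
  obtains S where "S \<in> SU" "\<And>\<rho>. U ** \<rho> ** dagger U = S ** \<rho> ** dagger S"
proof -
  define d where "d = csqrt (det U)"
  have "det (dagger U) = cnj (det U)" by (simp add: det_2)
  then have "cnj (det U) * det U = 1"
    using assms by (metis unitary_def det_mul det_I)
  then have "(cmod (det U))\<^sup>2 = 1"
    by (metis complex_norm_square mult.commute of_real_eq_1_iff)
  then have "cmod d = 1"
    by (simp add: d_def norm_csqrt abs_square_eq_1)
  then have d: "cnj d * d = 1" "d * cnj d = 1"
    by (simp_all add: mult.commute flip: complex_norm_square)
  have d2: "d * d = det U" by (simp add: d_def flip: power2_eq_square)
  define S where "S = cnj d *\<^sub>C U"
  have "cnj d ^ 2 * det U = (cnj d * d) * (cnj d * d)"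
    by (simp flip: d2 add: power2_eq_square)
  then have "det S = 1" by (simp add: S_def det_cscale d)
  moreover have "unitary S"
    using assms by (simp add: S_def unitary_def dagger_cscale cscale_matrix_mult_left
        cscale_matrix_mult_right d)
  moreover have "U ** \<rho> ** dagger U = S ** \<rho> ** dagger S" for \<rho>
    by (simp add: S_def dagger_cscale cscale_matrix_mult_left cscale_matrix_mult_right d)
  ultimately show thesis using that[of S] by (simp add: SU_def)
qed

text \<open>Targets given by unitary equivalence and targets given by \<open>SU\<close> agree, since
  phases drop out and conjugation preserves density matrices.\<close>

lemma strong_UIC_iff: "strong_UIC \<L> \<longleftrightarrow> indirectly_controllable (lie_group \<L>)"
proof
  assume uic: "strong_UIC \<L>"
  show "indirectly_controllable (lie_group \<L>)"
    unfolding indirectly_controllable_def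
  proof (intro allI impI)
    fix \<rho>S \<rho>A X\<^sub>S :: "complex^2^2"
    assume \<rho>: "density_matrix \<rho>S" "density_matrix \<rho>A" and "X\<^sub>S \<in> SU"
    then have X: "unitary X\<^sub>S" by (simp add: SU_def)
    then have "unitarily_equivalent \<rho>S (X\<^sub>S ** \<rho>S ** dagger X\<^sub>S)"
      unfolding unitarily_equivalent_def by blast
    then show "\<exists>X\<in>lie_group \<L>. ptrace_A (X ** (\<rho>S \<otimes>\<^sub>K \<rho>A) ** dagger X) = X\<^sub>S ** \<rho>S ** dagger X\<^sub>S"
      using uic \<rho> density_matrix_unitary[OF \<rho>(1) X] unfolding strong_UIC_def UIC_def
      by (metis singletonD)
  qed
next
  assume ctrl: "indirectly_controllable (lie_group \<L>)"
  show "strong_UIC \<L>"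
    unfolding strong_UIC_def UIC_def unitarily_equivalent_def
  proof (intro allI impI)
    fix \<rho>A \<rho>S \<rho> :: "complex^2^2"
    assume \<rho>: "density_matrix \<rho>A" "density_matrix \<rho>S" and "\<exists>U. unitary U \<and> \<rho> = U ** \<rho>S ** dagger U"
    then obtain U where U: "unitary U" "\<rho> = U ** \<rho>S ** dagger U" by blast
    obtain S where "S \<in> SU" "\<rho> = S ** \<rho>S ** dagger S"
      using unitary_2_conjugation[OF U(1)] U(2) by metis
    then show "\<exists>\<rho>A\<in>{\<rho>A}. \<exists>X\<in>lie_group \<L>. \<rho> = ptrace_A (X ** (\<rho>S \<otimes>\<^sub>K \<rho>A) ** dagger X)"
      using ctrl \<rho> unfolding indirectly_controllable_def by (metis singletonI)
  qed
qed

theorem theorem4: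
  fixes B C \<tau>1 \<tau>2 \<tau>3 :: "complex^2^2"
    and K :: "'k set" and L :: "'k \<Rightarrow> complex^2^2"
    and \<B> \<L> :: "(complex^(2 \<times> 2)^(2 \<times> 2)) set"
  assumes "\<i> *\<^sub>C B \<in> su" and "\<i> *\<^sub>C C \<in> su"
    and "\<tau>1 \<in> su" and "\<tau>2 \<in> su" and "\<tau>3 \<in> su"
    and "\<not> (\<tau>1 = 0 \<and> \<tau>2 = 0 \<and> \<tau>3 = 0)"
    and "finite K"
    and "\<B> = control_lie_algebra K L"
    and "\<B> = (\<lambda>Q. mat 1 \<otimes>\<^sub>K Q) ` su"
    and "\<L> = dynamical_lie_algebra (H_S B + H_I \<tau>1 \<tau>2 \<tau>3 + H_A C) \<B>"
  shows "(strong_UIC \<L> \<longleftrightarrow> completely_controllable \<L>) \<and>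
    (strong_UIC \<L> \<longleftrightarrow>
      (\<forall>\<rho>S \<rho>A X\<^sub>S. density_matrix \<rho>S \<longrightarrow> density_matrix \<rho>A \<longrightarrow> X\<^sub>S \<in> SU \<longrightarrow>
        (\<exists>X\<in>lie_group \<L>. ptrace_A (X ** (\<rho>S \<otimes>\<^sub>K \<rho>A) ** dagger X) = X\<^sub>S ** \<rho>S ** dagger X\<^sub>S))) \<and>
    (completely_controllable \<L> \<longleftrightarrow> lie_group \<L> = SU) \<and>
    (completely_controllable \<L> \<longleftrightarrow> \<L> = su)"
proof -
  from assms(1-5) obtain b q t1 t2 t3 where b: "\<i> *\<^sub>C B = su2 b" and q: "\<i> *\<^sub>C C = su2 q"
    and t: "\<tau>1 = su2 t1" "\<tau>2 = su2 t2" "\<tau>3 = su2 t3"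
    unfolding su_eq_range_su2 by blast
  let ?N = "su2 b \<otimes>\<^sub>K mat 1 + \<i> *\<^sub>C (su2 t1 \<otimes>\<^sub>K su2 (axis 1 1)) + \<i> *\<^sub>C (su2 t2 \<otimes>\<^sub>K su2 (axis 2 1)) +
    \<i> *\<^sub>C (su2 t3 \<otimes>\<^sub>K su2 (axis 3 1))"
  \<comment> \<open>The imaginary unit is absorbed into \<open>B\<close> and \<open>C\<close>, but
    stays in front of the couplings, whose two factors are both skew-Hermitian already.\<close>
  have "\<i> *\<^sub>C (H_S B + H_I \<tau>1 \<tau>2 \<tau>3 + H_A C) = ?N + mat 1 \<otimes>\<^sub>K su2 q"
    unfolding b[symmetric] q[symmetric] t su2_eq_sigma H_S_def H_I_def H_A_def
    by (simp add: kron_cscale_left kron_cscale_right) (simp add: vec_eq_iff distrib_left)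
  then have \<L>: "\<L> = lie_generated (insert (?N + mat 1 \<otimes>\<^sub>K su2 q) (range (\<lambda>y. mat 1 \<otimes>\<^sub>K su2 y)))"
    unfolding assms(10) assms(9) dynamical_lie_algebra_def su_eq_range_su2 by (simp add: image_image)
  have "\<not> (t1 = 0 \<and> t2 = 0 \<and> t3 = 0)" using assms(6) t su2_0 by metis
  then have cases: "\<L> = su \<or> (\<exists>a c. obstructed (lie_group \<L>) a c)"
    unfolding \<L> by (rule dynamical_lie_algebra_cases)
  have "\<L> \<subseteq> su"
    unfolding \<L>
  proof (rule lie_generated_minimal[OF _ real_lie_algebra_su])
    have "?N + mat 1 \<otimes>\<^sub>K su2 q \<in> su"
      using subspace_su
      by (intro subspace_add)
         (simp_all add: su_def dagger_kron dagger_cscale dagger_su2 trace_cscale trace_kron trace_su2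
           kron.minus_left kron.minus_right cscale_minus_left)
    then show "insert (?N + mat 1 \<otimes>\<^sub>K su2 q) (range (\<lambda>y. mat 1 \<otimes>\<^sub>K su2 y)) \<subseteq> su"
      by (auto simp: su_def dagger_kron dagger_su2 trace_kron trace_su2 kron.minus_right)
  qed
  then have skew: "\<L> \<subseteq> skew_hermitian" using su_subset_skew_hermitian by blast
  \<comment> \<open>The next four implications form a cycle, which gives all the equivalences at
    once.\<close>
  have 1: "indirectly_controllable (lie_group \<L>)" if "completely_controllable \<L>"
    using that by (intro SU_imp_indirectly_controllable) (auto simp: completely_controllable_def)
  have 2: "\<L> = su" if "indirectly_controllable (lie_group \<L>)"
    using that cases obstructed_imp_not_indirectly_controllable[OF _ skew] by blast
  have 3: "lie_group \<L> = SU" if "\<L> = su"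
    unfolding that by (rule lie_group_su)
  have 4: "completely_controllable \<L>" if "lie_group \<L> = SU"
    using that by (simp add: completely_controllable_def)
  show ?thesis
    using 1 2 3 4 unfolding strong_UIC_iff indirectly_controllable_def[symmetric] by blast
qed

end
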